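(* Let $\mathbb{T}$ be a topology over a vocabulary $\mathcal{V}_{\mathsf{Node}}$, and let $\mathcal{H}$ be a $\mathbb{T}$-proof space generated by a finite basis in normal form. If $\mathbb{T}^d/{\simeq}$ is finite for every $d\in\mathbb{N}_+$, then $\mathcal{L}(\mathcal{H})$ is a $\mathbb{T}$-PAL.
   Context: For a structure and a set $V$ of elements, $N(V)$ is the substructure generated by $V$; $N(\vec a)$ that of the entries of tuple $\vec a$; juxtaposition is concatenation. For tuples $\vec a,\vec b\in\mathbb{T}^d$, $\vec a\simeq\vec b$ if there is an isomorphism $\beta:N(\vec a)\to N(\vec b)$ with $\beta(\vec a)=\vec b$. Fix a finite command set $\Sigma$ and a data vocabulary $\mathcal{V}_{\mathsf{Data}}$. Hoare triples and proof spaces. An assertion is $\phi[\mu(u_1),\dots,\mu(u_m)]$ with $\phi[x_1,\dots,x_m]$ a $\mathcal{V}_{\mathsf{Data}}$-formula, $u_j\in\mathbb{T}$, $\mu$ a formal unary symbol. Hoare triples are $\{A\}\rho\{B\}$ with $\rho\in(\Sigma\times\mathbb{T})^*$; assertions are viewed as conjunctions of conjuncts. Rules: Sequencing — from $\{A_1\}\rho_1\{A_2\}$, $\{A_2'\}\rho_2\{A_3\}$ with each conjunct of $A_2'$ a conjunct of $A_2$, derive $\{A_1\}\rho_1\rho_2\{A_3\}$; Conjunction — from $\{A_1\}\rho\{B_1\}$, $\{A_2\}\rho\{B_2\}$ derive $\{A_1\wedge A_2\}\rho\{B_1\wedge B_2\}$; S-param — from $\{\phi[\overrightarrow{\mu(u)}]\}\langle\sigma_1:v_1\rangle\cdots\langle\sigma_n:v_n\rangle\{\psi[\overrightarrow{\mu(w)}]\}$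 derive the triple with $\vec u',\vec v',\vec w'$ in place of $\vec u,\vec v,\vec w$ whenever lengths agree and $\vec u\vec v\vec w\simeq\vec u'\vec v'\vec w'$. A $\mathbb{T}$-proof space is a set of triples closed under these rules; it is generated by a set $H$ (a basis) if it is the smallest one containing $H$. $\mathcal{L}(\mathcal{H})=\{\rho:\{\top\}\rho\{\bot\}\in\mathcal{H}\}$. A triple is in normal form if it has the form $\{\phi[\mu(a_1),\dots,\mu(a_m)]\}\langle\sigma:b\rangle\{\psi[\mu(c_1),\dots,\mu(c_p)]\}$ with $\{a_j\}\subseteq N(b,\vec c)$ and $\psi$ syntactically not a conjunction; a basis is in normal form if all its triples are. $\mathbb{T}$-predicate automata. $\mathcal{V}_{\mathsf{Node}}[\mathbb{T}]$ expands $\mathcal{V}_{\mathsf{Node}}$ by a constant per node. A $\mathbb{T}$-PA is $A=(\mathcal{Q},\Sigma\times\mathbb{T},\delta,\varphi_{\mathsf{start}},F)$: $\mathcal{Q}$ a finite relational vocabulary disjoint from $\mathcal{V}_{\mathsf{Node}}[\mathbb{T}]$; $\mathcal{F}_+$ the quantifier-free $(\mathcal{V}_{\mathsf{Node}}\cup\mathcal{Q})$-formulas with all $\mathcal{Q}$-atoms positive; $\varphi_{\mathsf{start}}\in\mathcal{F}_+$ without free variables; $F\subseteq\mathcal{Q}$; $\delta:\mathcal{Q}\times\Sigma\to\mathcal{F}_+$ with free variables of $\delta(q,\sigma)$ among $v_0,\dots,v_{\mathsf{ar}(q)}$. States are atoms $q(a_1,\dots,a_{\mathsf{ar}(q)})$,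 $a_j\in\mathbb{T}$; $\hat\delta(q(a_1,\dots),\langle\sigma:a_0\rangle)$ is $\delta(q,\sigma)$ with $v_j\mapsto a_j$ and $\mathcal{V}_{\mathsf{Node}}$-atoms evaluated in $\mathbb{T}$. A configuration is a finite set of states (a conjunction); initial if a cube of the DNF of $\varphi_{\mathsf{start}}$; accepting if all its predicate symbols are in $F$. $\mathcal{C}\xrightarrow{\sigma:a}\mathcal{C}'$ iff $\mathcal{C}'$ is a cube of the DNF of $\bigwedge_{t\in\mathcal{C}}\hat\delta(t,\langle\sigma:a\rangle)$. A word $\langle\sigma_1:a_1\rangle\cdots\langle\sigma_n:a_n\rangle$ is accepted if there are configurations $\mathcal{C}_0,\dots,\mathcal{C}_n$ with $\mathcal{C}_n$ initial, $\mathcal{C}_0$ accepting and $\mathcal{C}_r\xrightarrow{\sigma_r:a_r}\mathcal{C}_{r-1}$. A $\mathbb{T}$-PAL is the set of words accepted by some $\mathbb{T}$-PA. *)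

theory Defs
  imports Main
begin

section \<open>Vocabularies, terms, structures\<close>

record ('f, 'r) vocab =
  funs :: "'f set"
  rels :: "'r set"
  far :: "'f \<Rightarrow> nat"
  rar :: "'r \<Rightarrow> nat"

datatype (dead 'f, tm_vars: 'v) tm = Var 'v | Fn 'f "('f, 'v) tm list"

fun wf_tm :: "('f, 'r) vocab \<Rightarrow> ('f, 'v) tm \<Rightarrow> bool" where
  "wf_tm V (Var x) \<longleftrightarrow> True"
| "wf_tm V (Fn f ts) \<longleftrightarrow> f \<in> funs V \<and> length ts = far V f \<and> (\<forall>t \<in> set ts. wf_tm V t)"

text \<open>The universe of a structure is the whole type \<^typ>\<open>'n\<close>. Only the values of the
  interpretations at symbols of the vocabulary and at argument lists of the right length
  are ever consulted.\<close>

record ('f, 'r, 'n) struct =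
  fint :: "'f \<Rightarrow> 'n list \<Rightarrow> 'n"
  rint :: "'r \<Rightarrow> 'n list \<Rightarrow> bool"

fun eval_tm :: "('f, 'r, 'n) struct \<Rightarrow> ('v \<Rightarrow> 'n) \<Rightarrow> ('f, 'v) tm \<Rightarrow> 'n" where
  "eval_tm T e (Var x) = e x"
| "eval_tm T e (Fn f ts) = fint T f (map (eval_tm T e) ts)"

inductive_set generated :: "('f, 'r) vocab \<Rightarrow> ('f, 'r, 'n) struct \<Rightarrow> 'n set \<Rightarrow> 'n set"
  for V T X where
  base: "x \<in> X \<Longrightarrow> x \<in> generated V T X"
| app: "\<lbrakk>f \<in> funs V; length xs = far V f; \<forall>x \<in> set xs. x \<in> generated V T X\<rbrakk>
          \<Longrightarrow> fint T f xs \<in> generated V T X"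

definition substructure_iso ::
  "('f, 'r) vocab \<Rightarrow> ('f, 'r, 'n) struct \<Rightarrow> 'n set \<Rightarrow> 'n set \<Rightarrow> ('n \<Rightarrow> 'n) \<Rightarrow> bool" where
  "substructure_iso V T M N \<beta> \<longleftrightarrow>
     bij_betw \<beta> M N \<and>
     (\<forall>f \<in> funs V. \<forall>xs. length xs = far V f \<and> set xs \<subseteq> M \<longrightarrow>
        \<beta> (fint T f xs) = fint T f (map \<beta> xs)) \<and>
     (\<forall>r \<in> rels V. \<forall>xs. length xs = rar V r \<and> set xs \<subseteq> M \<longrightarrow>
        rint T r (map \<beta> xs) = rint T r xs)"

definition simeq :: "('f, 'r) vocab \<Rightarrow> ('f, 'r, 'n) struct \<Rightarrow> 'n list \<Rightarrow> 'n list \<Rightarrow> bool" where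
  "simeq V T as bs \<longleftrightarrow>
     (\<exists>\<beta>. substructure_iso V T (generated V T (set as)) (generated V T (set bs)) \<beta> \<and>
          map \<beta> as = bs)"

definition tuples :: "nat \<Rightarrow> 'n list set" where
  "tuples d = {as. length as = d}"

definition simeq_rel ::
  "('f, 'r) vocab \<Rightarrow> ('f, 'r, 'n) struct \<Rightarrow> nat \<Rightarrow> ('n list \<times> 'n list) set" where
  "simeq_rel V T d = {(as, bs). as \<in> tuples d \<and> bs \<in> tuples d \<and> simeq V T as bs}"


section \<open>Data formulas and assertions\<close>

text \<open>First-order formulas over a data vocabulary. A leaf \<open>Var (Inl x)\<close> is a free variable
  \<open>x\<close>, and \<open>Var (Inr i)\<close> is a bound variable given as a de Bruijn index.
  The type \<^typ>\<open>'v\<close> is \<^typ>\<open>nat\<close> for the formulas \<open>\<phi>[x\<^sub>1,\<dots>,x\<^sub>m]\<close>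
  (\<open>x\<^sub>j\<close> being the index \<open>j - 1\<close>), and the type of nodes for assertions, where
  the leaf \<open>Var (Inl u)\<close> stands for the formal term \<open>\<mu>(u)\<close>.\<close>

datatype (dead 'f, dead 'r, fm_fv: 'v) fm =
    Top
  | Bot
  | Eq "('f, 'v + nat) tm" "('f, 'v + nat) tm"
  | Rel 'r "('f, 'v + nat) tm list"
  | Neg "('f, 'r, 'v) fm"
  | And "('f, 'r, 'v) fm" "('f, 'r, 'v) fm"
  | Or "('f, 'r, 'v) fm" "('f, 'r, 'v) fm"
  | All "('f, 'r, 'v) fm"
  | Ex "('f, 'r, 'v) fm"

definition wf_open_tm :: "('f, 'r) vocab \<Rightarrow> nat \<Rightarrow> ('f, 'v + nat) tm \<Rightarrow> bool" where
  "wf_open_tm D k t \<longleftrightarrow> wf_tm D t \<and> (\<forall>i. Inr i \<in> tm_vars t \<longrightarrow> i < k)"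

fun wf_fm :: "('f, 'r) vocab \<Rightarrow> nat \<Rightarrow> ('f, 'r, 'v) fm \<Rightarrow> bool" where
  "wf_fm D k Top \<longleftrightarrow> True"
| "wf_fm D k Bot \<longleftrightarrow> True"
| "wf_fm D k (Eq s t) \<longleftrightarrow> wf_open_tm D k s \<and> wf_open_tm D k t"
| "wf_fm D k (Rel r ts) \<longleftrightarrow>
     r \<in> rels D \<and> length ts = rar D r \<and> (\<forall>t \<in> set ts. wf_open_tm D k t)"
| "wf_fm D k (Neg \<phi>) \<longleftrightarrow> wf_fm D k \<phi>"
| "wf_fm D k (And \<phi> \<psi>) \<longleftrightarrow> wf_fm D k \<phi> \<and> wf_fm D k \<psi>"
| "wf_fm D k (Or \<phi> \<psi>) \<longleftrightarrow> wf_fm D k \<phi> \<and> wf_fm D k \<psi>"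
| "wf_fm D k (All \<phi>) \<longleftrightarrow> wf_fm D (Suc k) \<phi>"
| "wf_fm D k (Ex \<phi>) \<longleftrightarrow> wf_fm D (Suc k) \<phi>"

text \<open>\<open>\<phi>[x\<^sub>1,\<dots>,x\<^sub>m]\<close> lists precisely the free variables of \<open>\<phi>\<close>. If dummy variables
  were admitted, the normal-form condition below would be void: any node could be made
  an entry of \<open>c\<close> without occurring in the postcondition.\<close>

definition fm_ctx :: "('f, 'r) vocab \<Rightarrow> nat \<Rightarrow> ('f, 'r, nat) fm \<Rightarrow> bool" where
  "fm_ctx D m \<phi> \<longleftrightarrow> wf_fm D 0 \<phi> \<and> fm_fv \<phi> = {..<m}"

fun conjuncts :: "('f, 'r, 'v) fm \<Rightarrow> ('f, 'r, 'v) fm set" where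
  "conjuncts (And \<phi> \<psi>) = conjuncts \<phi> \<union> conjuncts \<psi>"
| "conjuncts \<phi> = {\<phi>}"

text \<open>An assertion is viewed as a conjunction of conjuncts, i.e. it is represented by its set of
  conjuncts; conjunction of assertions is union. In particular \<open>\<top> \<and> \<top>\<close> and \<open>\<top>\<close>
  are the same assertion, whose only conjunct is \<open>\<top>\<close>.\<close>

type_synonym ('f, 'r, 'n) assertion = "('f, 'r, 'n) fm set"

definition inst :: "('f, 'r, nat) fm \<Rightarrow> 'n list \<Rightarrow> ('f, 'r, 'n) assertion" where
  "inst \<phi> us = conjuncts (map_fm (\<lambda>j. us ! j) \<phi>)"

definition is_assertion :: "('f, 'r) vocab \<Rightarrow> ('f, 'r, 'n) assertion \<Rightarrow> bool" where
  "is_assertion D A \<longleftrightarrow> (\<exists>\<phi> us. fm_ctx D (length us) \<phi> \<and> A = inst \<phi> us)"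


section \<open>Hoare triples and proof spaces\<close>

type_synonym ('s, 'n) word = "('s \<times> 'n) list"

type_synonym ('f, 'r, 's, 'n) triple =
  "('f, 'r, 'n) assertion \<times> ('s, 'n) word \<times> ('f, 'r, 'n) assertion"

definition triples :: "('f, 'r) vocab \<Rightarrow> 's set \<Rightarrow> ('f, 'r, 's, 'n) triple set" where
  "triples D \<Sigma> = {(A, \<rho>, B). is_assertion D A \<and> set \<rho> \<subseteq> \<Sigma> \<times> UNIV \<and> is_assertion D B}"

definition closed_sequencing :: "('f, 'r, 's, 'n) triple set \<Rightarrow> bool" where
  "closed_sequencing P \<longleftrightarrow>
     (\<forall>A1 \<rho>1 A2 A2' \<rho>2 A3.
        (A1, \<rho>1, A2) \<in> P \<and> (A2', \<rho>2, A3) \<in> P \<and> A2' \<subseteq> A2 \<longrightarrow> (A1, \<rho>1 @ \<rho>2, A3) \<in> P)"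

definition closed_conjunction :: "('f, 'r, 's, 'n) triple set \<Rightarrow> bool" where
  "closed_conjunction P \<longleftrightarrow>
     (\<forall>A1 A2 \<rho> B1 B2.
        (A1, \<rho>, B1) \<in> P \<and> (A2, \<rho>, B2) \<in> P \<longrightarrow> (A1 \<union> A2, \<rho>, B1 \<union> B2) \<in> P)"

definition closed_sparam ::
  "('nf, 'nr) vocab \<Rightarrow> ('nf, 'nr, 'n) struct \<Rightarrow> ('f, 'r) vocab \<Rightarrow>
   ('f, 'r, 's, 'n) triple set \<Rightarrow> bool" where
  "closed_sparam V T D P \<longleftrightarrow>
     (\<forall>\<phi> \<psi> \<sigma>s us vs ws us' vs' ws'.
        fm_ctx D (length us) \<phi> \<and> fm_ctx D (length ws) \<psi> \<and> length \<sigma>s = length vs \<and>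
        (inst \<phi> us, zip \<sigma>s vs, inst \<psi> ws) \<in> P \<and>
        length us' = length us \<and> length vs' = length vs \<and> length ws' = length ws \<and>
        simeq V T (us @ vs @ ws) (us' @ vs' @ ws') \<longrightarrow>
        (inst \<phi> us', zip \<sigma>s vs', inst \<psi> ws') \<in> P)"

definition proof_space ::
  "('nf, 'nr) vocab \<Rightarrow> ('nf, 'nr, 'n) struct \<Rightarrow> ('f, 'r) vocab \<Rightarrow> 's set \<Rightarrow>
   ('f, 'r, 's, 'n) triple set \<Rightarrow> bool" where
  "proof_space V T D \<Sigma> P \<longleftrightarrow>
     P \<subseteq> triples D \<Sigma> \<and> closed_sequencing P \<and> closed_conjunction P \<and> closed_sparam V T D P"

definition generated_by ::
  "('nf, 'nr) vocab \<Rightarrow> ('nf, 'nr, 'n) struct \<Rightarrow> ('f, 'r) vocab \<Rightarrow> 's set \<Rightarrow>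
   ('f, 'r, 's, 'n) triple set \<Rightarrow> ('f, 'r, 's, 'n) triple set \<Rightarrow> bool" where
  "generated_by V T D \<Sigma> P H \<longleftrightarrow>
     proof_space V T D \<Sigma> P \<and> H \<subseteq> P \<and>
     (\<forall>P'. proof_space V T D \<Sigma> P' \<and> H \<subseteq> P' \<longrightarrow> P \<subseteq> P')"

definition triple_normal_form ::
  "('nf, 'nr) vocab \<Rightarrow> ('nf, 'nr, 'n) struct \<Rightarrow> ('f, 'r) vocab \<Rightarrow>
   ('f, 'r, 's, 'n) triple \<Rightarrow> bool" where
  "triple_normal_form V T D t \<longleftrightarrow>
     (\<exists>\<phi> as \<sigma> b \<psi> cs.
        fm_ctx D (length as) \<phi> \<and> fm_ctx D (length cs) \<psi> \<and>
        t = (inst \<phi> as, [(\<sigma>, b)], inst \<psi> cs) \<and>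
        set as \<subseteq> generated V T (insert b (set cs)) \<and>
        (\<forall>\<psi>1 \<psi>2. \<psi> \<noteq> And \<psi>1 \<psi>2))"

definition basis_normal_form ::
  "('nf, 'nr) vocab \<Rightarrow> ('nf, 'nr, 'n) struct \<Rightarrow> ('f, 'r) vocab \<Rightarrow>
   ('f, 'r, 's, 'n) triple set \<Rightarrow> bool" where
  "basis_normal_form V T D H \<longleftrightarrow> (\<forall>t \<in> H. triple_normal_form V T D t)"

definition proof_space_lang :: "('f, 'r, 's, 'n) triple set \<Rightarrow> ('s, 'n) word set" where
  "proof_space_lang P = {\<rho>. (inst Top [], \<rho>, inst Bot []) \<in> P}"


section \<open>Predicate automata\<close>

text \<open>Quantifier-free formulas over the disjoint union of a node vocabulary (function symbols
  \<^typ>\<open>'f\<close>, relation symbols \<^typ>\<open>'r\<close>) and a relational vocabulary with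
  symbols in \<^typ>\<open>'q\<close>.\<close>

datatype (dead 'f, dead 'r, dead 'q, qf_vars: 'v) qf =
    QTop
  | QBot
  | QEq "('f, 'v) tm" "('f, 'v) tm"
  | QRel 'r "('f, 'v) tm list"
  | QPred 'q "('f, 'v) tm list"
  | QNeg "('f, 'r, 'q, 'v) qf"
  | QAnd "('f, 'r, 'q, 'v) qf" "('f, 'r, 'q, 'v) qf"
  | QOr "('f, 'r, 'q, 'v) qf" "('f, 'r, 'q, 'v) qf"

record ('f, 'r, 'q, 's) pa =
  preds :: "'q set"
  par :: "'q \<Rightarrow> nat"
  delta :: "'q \<Rightarrow> 's \<Rightarrow> ('f, 'r, 'q, nat) qf"
  start :: "('f, 'r, 'q, nat) qf"
  final :: "'q set"

fun wf_qf :: "('f, 'r) vocab \<Rightarrow> 'q set \<Rightarrow> ('q \<Rightarrow> nat) \<Rightarrow> ('f, 'r, 'q, 'v) qf \<Rightarrow> bool" where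
  "wf_qf V Q ar QTop \<longleftrightarrow> True"
| "wf_qf V Q ar QBot \<longleftrightarrow> True"
| "wf_qf V Q ar (QEq s t) \<longleftrightarrow> wf_tm V s \<and> wf_tm V t"
| "wf_qf V Q ar (QRel r ts) \<longleftrightarrow> r \<in> rels V \<and> length ts = rar V r \<and> (\<forall>t \<in> set ts. wf_tm V t)"
| "wf_qf V Q ar (QPred q ts) \<longleftrightarrow> q \<in> Q \<and> length ts = ar q \<and> (\<forall>t \<in> set ts. wf_tm V t)"
| "wf_qf V Q ar (QNeg \<phi>) \<longleftrightarrow> wf_qf V Q ar \<phi>"
| "wf_qf V Q ar (QAnd \<phi> \<psi>) \<longleftrightarrow> wf_qf V Q ar \<phi> \<and> wf_qf V Q ar \<psi>"
| "wf_qf V Q ar (QOr \<phi> \<psi>) \<longleftrightarrow> wf_qf V Q ar \<phi> \<and> wf_qf V Q ar \<psi>"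

text \<open>\<open>preds_polarity p \<phi>\<close>: all \<^typ>\<open>'q\<close>-atoms of \<open>\<phi>\<close> have polarity \<open>p\<close>
  (\<open>True\<close> is positive).\<close>

fun preds_polarity :: "bool \<Rightarrow> ('f, 'r, 'q, 'v) qf \<Rightarrow> bool" where
  "preds_polarity p QTop \<longleftrightarrow> True"
| "preds_polarity p QBot \<longleftrightarrow> True"
| "preds_polarity p (QEq s t) \<longleftrightarrow> True"
| "preds_polarity p (QRel r ts) \<longleftrightarrow> True"
| "preds_polarity p (QPred q ts) \<longleftrightarrow> p"
| "preds_polarity p (QNeg \<phi>) \<longleftrightarrow> preds_polarity (\<not> p) \<phi>"
| "preds_polarity p (QAnd \<phi> \<psi>) \<longleftrightarrow> preds_polarity p \<phi> \<and> preds_polarity p \<psi>"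
| "preds_polarity p (QOr \<phi> \<psi>) \<longleftrightarrow> preds_polarity p \<phi> \<and> preds_polarity p \<psi>"

definition F_plus ::
  "('f, 'r) vocab \<Rightarrow> 'q set \<Rightarrow> ('q \<Rightarrow> nat) \<Rightarrow> ('f, 'r, 'q, 'v) qf set" where
  "F_plus V Q ar = {\<phi>. wf_qf V Q ar \<phi> \<and> preds_polarity True \<phi>}"

definition wf_pa :: "('f, 'r) vocab \<Rightarrow> 's set \<Rightarrow> ('f, 'r, 'q, 's) pa \<Rightarrow> bool" where
  "wf_pa V \<Sigma> A \<longleftrightarrow>
     finite (preds A) \<and>
     start A \<in> F_plus V (preds A) (par A) \<and> qf_vars (start A) = {} \<and>
     final A \<subseteq> preds A \<and>
     (\<forall>q \<in> preds A. \<forall>\<sigma> \<in> \<Sigma>.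
        delta A q \<sigma> \<in> F_plus V (preds A) (par A) \<and> qf_vars (delta A q \<sigma>) \<subseteq> {..par A q})"

type_synonym ('q, 'n) state = "'q \<times> 'n list"
type_synonym ('q, 'n) config = "('q, 'n) state set"

text \<open>\<open>cubes T e True \<phi>\<close> is the set of cubes of the DNF of \<open>\<phi>\<close> under the assignment
  \<open>e\<close>, and \<open>cubes T e False \<phi>\<close> that of the negation of \<open>\<phi>\<close>: node atoms are evaluated in
  the structure, negations are pushed inwards, and conjunction is distributed over disjunction.
  A cube is the (always finite) set of states it conjoins. A negatively occurring
  \<^typ>\<open>'q\<close>-atom does not exist in positive formulas; its value here is arbitrary.\<close>

fun cubes ::
  "('f, 'r, 'n) struct \<Rightarrow> ('v \<Rightarrow> 'n) \<Rightarrow> bool \<Rightarrow> ('f, 'r, 'q, 'v) qf \<Rightarrow> ('q, 'n) config set" where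
  "cubes T e p QTop = (if p then {{}} else {})"
| "cubes T e p QBot = (if p then {} else {{}})"
| "cubes T e p (QEq s t) = (if (eval_tm T e s = eval_tm T e t) = p then {{}} else {})"
| "cubes T e p (QRel r ts) = (if rint T r (map (eval_tm T e) ts) = p then {{}} else {})"
| "cubes T e p (QPred q ts) = (if p then {{(q, map (eval_tm T e) ts)}} else {})"
| "cubes T e p (QNeg \<phi>) = cubes T e (\<not> p) \<phi>"
| "cubes T e p (QAnd \<phi> \<psi>) =
     (if p then {X \<union> Y | X Y. X \<in> cubes T e p \<phi> \<and> Y \<in> cubes T e p \<psi>}
      else cubes T e p \<phi> \<union> cubes T e p \<psi>)"
| "cubes T e p (QOr \<phi> \<psi>) =
     (if p then cubes T e p \<phi> \<union> cubes T e p \<psi>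
      else {X \<union> Y | X Y. X \<in> cubes T e p \<phi> \<and> Y \<in> cubes T e p \<psi>})"

text \<open>Cubes of \<open>\<delta>(q, \<sigma>)\<close> with \<open>v\<^sub>0\<close> replaced by the node of the letter and
  \<open>v\<^sub>1, v\<^sub>2, \<dots>\<close> by the arguments of the state.\<close>

fun delta_cubes ::
  "('f, 'r, 'n) struct \<Rightarrow> ('f, 'r, 'q, 's) pa \<Rightarrow> ('q, 'n) state \<Rightarrow> 's \<times> 'n \<Rightarrow> ('q, 'n) config set"
  where
  "delta_cubes T A (q, as) (\<sigma>, a0) = cubes T (\<lambda>j. (a0 # as) ! j) True (delta A q \<sigma>)"

text \<open>A cube of the DNF of a finite conjunction arises by choosing one cube of each conjunct.\<close>

definition pa_step ::
  "('f, 'r, 'n) struct \<Rightarrow> ('f, 'r, 'q, 's) pa \<Rightarrow> ('q, 'n) config \<Rightarrow> 's \<times> 'n \<Rightarrow>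
   ('q, 'n) config \<Rightarrow> bool" where
  "pa_step T A C l C' \<longleftrightarrow>
     (\<exists>g. (\<forall>t \<in> C. g t \<in> delta_cubes T A t l) \<and> C' = (\<Union>t \<in> C. g t))"

definition pa_initial ::
  "('f, 'r, 'n) struct \<Rightarrow> ('f, 'r, 'q, 's) pa \<Rightarrow> ('q, 'n) config \<Rightarrow> bool" where
  "pa_initial T A C \<longleftrightarrow> C \<in> cubes T undefined True (start A)"

definition pa_accepting :: "('f, 'r, 'q, 's) pa \<Rightarrow> ('q, 'n) config \<Rightarrow> bool" where
  "pa_accepting A C \<longleftrightarrow> fst ` C \<subseteq> final A"

text \<open>Words are read from right to left.\<close>

definition pa_accepts ::
  "('f, 'r, 'n) struct \<Rightarrow> ('f, 'r, 'q, 's) pa \<Rightarrow> ('s, 'n) word \<Rightarrow> bool" where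
  "pa_accepts T A w \<longleftrightarrow>
     (\<exists>C :: nat \<Rightarrow> ('q, 'n) config.
        pa_initial T A (C (length w)) \<and> pa_accepting A (C 0) \<and>
        (\<forall>r < length w. pa_step T A (C (Suc r)) (w ! r) (C r)))"

definition pa_lang ::
  "('f, 'r, 'n) struct \<Rightarrow> 's set \<Rightarrow> ('f, 'r, 'q, 's) pa \<Rightarrow> ('s, 'n) word set" where
  "pa_lang T \<Sigma> A = {w. set w \<subseteq> \<Sigma> \<times> UNIV \<and> pa_accepts T A w}"

text \<open>Since the vocabulary of an automaton is finite, its symbols may be taken to be naturals.\<close>

definition is_PAL ::
  "('f, 'r) vocab \<Rightarrow> ('f, 'r, 'n) struct \<Rightarrow> 's set \<Rightarrow> ('s, 'n) word set \<Rightarrow> bool" where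
  "is_PAL V T \<Sigma> L \<longleftrightarrow>
     (\<exists>A :: ('f, 'r, nat, 's) pa. wf_pa V \<Sigma> A \<and> L = pa_lang T \<Sigma> A)"

end

theory Submission imports Defs begin

text \<open>
  Read a word forwards and collect the set of conjuncts derivable from \<open>\<top>\<close>: a letter turns a set
  \<open>A\<close> into the set of postconditions of those S-param instances of basis triples whose
  preconditions lie in \<open>A\<close>. Because the basis is in normal form, the nodes of a precondition are
  values of fixed terms in the nodes of the letter and the postcondition. So the isomorphism used
  in an application of S-param to a derived triple can be applied to its whole derivation, and every
  derived triple is already obtained in this forward way.

  The automaton performs the same computation backwards; its states are instances of conjuncts
  of basis preconditions. Its transitions must test to which \<open>\<simeq>\<close>-class the tuple of the
  letter and the state belongs. Inequivalent tuples differ on an atomic formula, so if there are only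
  finitely many classes, each of them is defined by a finite conjunction of literals.
\<close>

section \<open>Generated substructures and their isomorphisms\<close>

lemma eval_tm_cong:
  "(\<And>x. x \<in> tm_vars t \<Longrightarrow> e x = e' x) \<Longrightarrow> eval_tm T e t = eval_tm T e' t"
proof (induction t)
  case (Fn f ts)
  then have "map (eval_tm T e) ts = map (eval_tm T e') ts" by (intro map_cong) auto
  then show ?case by (simp only: eval_tm.simps)
qed simp

lemma generated_least:
  assumes "X \<subseteq> generated V T Y"
  shows "generated V T X \<subseteq> generated V T Y"
proof
  fix x assume "x \<in> generated V T X"
  then show "x \<in> generated V T Y"
    by induction (use assms in \<open>auto intro: generated.app\<close>)
qed

lemma eval_tm_in_generated:
  assumes "wf_tm V t" "\<And>x. x \<in> tm_vars t \<Longrightarrow> e x \<in> generated V T X"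
  shows "eval_tm T e t \<in> generated V T X"
  using assms
proof (induction t)
  case (Fn f ts)
  then have "\<forall>x \<in> set (map (eval_tm T e) ts). x \<in> generated V T X" by auto
  then show ?case using Fn.prems by (auto intro!: generated.app)
qed simp

lemma eval_tm_nth_in_generated:
  assumes "wf_tm V t" "tm_vars t \<subseteq> {..<length xs}"
  shows "eval_tm T ((!) xs) t \<in> generated V T (set xs)"
  using assms by (intro eval_tm_in_generated) (auto intro!: generated.base)

text \<open>Variables are positions in \<open>xs\<close>, so a term found here can be evaluated in
  every tuple of the same length. This names generated elements uniformly over a whole
  \<simeq>-class.\<close>

lemma generated_is_term_value:
  assumes "x \<in> generated V T (set xs)"
  shows "\<exists>t. wf_tm V t \<and> tm_vars t \<subseteq> {..<length xs} \<and> eval_tm T ((!) xs) t = x"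
  using assms
proof induction
  case (base x)
  then obtain i where "i < length xs" "xs ! i = x" by (auto simp: in_set_conv_nth)
  then show ?case by (intro exI[of _ "Var i"]) auto
next
  case (app f ys)
  then obtain g where g: "\<And>y. y \<in> set ys \<Longrightarrow>
      wf_tm V (g y) \<and> tm_vars (g y) \<subseteq> {..<length xs} \<and> eval_tm T ((!) xs) (g y) = y"
    by metis
  have "map (eval_tm T ((!) xs)) (map g ys) = ys" using g by (auto intro: map_idI)
  then show ?case using g app by (intro exI[of _ "Fn f (map g ys)"]) fastforce
qed

lemma eval_tm_iso:
  assumes "substructure_iso V T (generated V T X) N \<gamma>" "wf_tm V t"
    and "\<And>x. x \<in> tm_vars t \<Longrightarrow> e x \<in> generated V T X"
  shows "\<gamma> (eval_tm T e t) = eval_tm T (\<gamma> \<circ> e) t"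
  using assms(2,3)
proof (induction t)
  case (Fn f ts)
  have "set (map (eval_tm T e) ts) \<subseteq> generated V T X"
    using Fn.prems by (auto intro!: eval_tm_in_generated)
  then have "\<gamma> (fint T f (map (eval_tm T e) ts)) = fint T f (map \<gamma> (map (eval_tm T e) ts))"
    using assms(1) Fn.prems unfolding substructure_iso_def by (metis length_map wf_tm.simps(2))
  moreover have "map \<gamma> (map (eval_tm T e) ts) = map (eval_tm T (\<gamma> \<circ> e)) ts"
    unfolding map_map comp_apply using Fn by (intro map_cong) (auto simp: comp_def)
  ultimately show ?case by (simp only: eval_tm.simps)
qed auto

lemma eval_tm_nth_iso:
  assumes "substructure_iso V T (generated V T X) N \<gamma>" "wf_tm V t"
    and "tm_vars t \<subseteq> {..<length xs}" "set xs \<subseteq> generated V T X"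
  shows "\<gamma> (eval_tm T ((!) xs) t) = eval_tm T ((!) (map \<gamma> xs)) t"
proof -
  have "\<gamma> (eval_tm T ((!) xs) t) = eval_tm T (\<gamma> \<circ> (!) xs) t"
    using assms by (intro eval_tm_iso) (auto simp: subset_iff)
  also have "\<dots> = eval_tm T ((!) (map \<gamma> xs)) t"
    using assms(3) by (intro eval_tm_cong) auto
  finally show ?thesis .
qed

lemma iso_image_generated:
  assumes "substructure_iso V T (generated V T X) N \<gamma>" "Y \<subseteq> generated V T X"
  shows "\<gamma> ` generated V T Y = generated V T (\<gamma> ` Y)"
proof -
  have sub: "generated V T Y \<subseteq> generated V T X" using assms(2) by (rule generated_least)
  have fint: "\<gamma> (fint T f xs) = fint T f (map \<gamma> xs)"
    if "f \<in> funs V" "length xs = far V f" "set xs \<subseteq> generated V T Y" for f xs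
    using that sub assms(1) unfolding substructure_iso_def by blast
  have "\<gamma> x \<in> generated V T (\<gamma> ` Y)" if "x \<in> generated V T Y" for x
    using that
  proof induction
    case (app f xs)
    then have "\<gamma> (fint T f xs) = fint T f (map \<gamma> xs)" by (intro fint) auto
    then show ?case using app by (auto intro!: generated.app)
  qed (auto intro: generated.base)
  moreover have "x \<in> \<gamma> ` generated V T Y" if "x \<in> generated V T (\<gamma> ` Y)" for x
    using that
  proof induction
    case (app f xs)
    \<comment> \<open>The induction hypothesis supplies preimages of the arguments; applying
      \<open>f\<close> to them gives a preimage of the value, because \<gamma> commutes with
      \<open>f\<close>.\<close>
    define g where "g = inv_into (generated V T Y) \<gamma>"
    have g: "g x \<in> generated V T Y \<and> \<gamma> (g x) = x" if "x \<in> set xs" for x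
      using app that unfolding g_def by (auto simp: inv_into_into f_inv_into_f)
    have "map \<gamma> (map g xs) = xs" using g by (auto intro: map_idI)
    then have "\<gamma> (fint T f (map g xs)) = fint T f xs"
      using fint[of f "map g xs"] g app by auto
    moreover have "fint T f (map g xs) \<in> generated V T Y"
      using g app by (auto intro!: generated.app)
    ultimately show ?case by (metis image_eqI)
  qed (auto intro: generated.base)
  ultimately show ?thesis by blast
qed

lemma iso_restrict:
  assumes "substructure_iso V T (generated V T X) N \<gamma>" "set as \<subseteq> generated V T X"
  shows "substructure_iso V T (generated V T (set as)) (generated V T (set (map \<gamma> as))) \<gamma>"
proof -
  have "generated V T (set as) \<subseteq> generated V T X" using assms(2) by (rule generated_least)
  then show ?thesis
    using assms iso_image_generated[OF assms]
    unfolding substructure_iso_def bij_betw_def by (auto intro: inj_on_subset)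
qed

lemma simeq_map:
  assumes "substructure_iso V T (generated V T X) N \<gamma>" "set as \<subseteq> generated V T X"
  shows "simeq V T as (map \<gamma> as)"
  using iso_restrict[OF assms] unfolding simeq_def by blast

lemma simeq_length: "simeq V T as bs \<Longrightarrow> length as = length bs"
  unfolding simeq_def by auto

lemma simeq_refl: "simeq V T as as"
  unfolding simeq_def substructure_iso_def by (intro exI[of _ id]) auto

lemma simeq_trans:
  assumes "simeq V T as bs" "simeq V T bs cs"
  shows "simeq V T as cs"
proof -
  obtain \<beta> where \<beta>: "substructure_iso V T (generated V T (set as)) (generated V T (set bs)) \<beta>"
    "map \<beta> as = bs" using assms(1) unfolding simeq_def by auto
  obtain \<gamma> where \<gamma>: "substructure_iso V T (generated V T (set bs)) (generated V T (set cs)) \<gamma>"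
    "map \<gamma> bs = cs" using assms(2) unfolding simeq_def by auto
  have img: "\<beta> ` generated V T (set as) = generated V T (set bs)"
    using \<beta>(1) unfolding substructure_iso_def bij_betw_def by auto
  have "substructure_iso V T (generated V T (set as)) (generated V T (set cs)) (\<gamma> \<circ> \<beta>)"
    unfolding substructure_iso_def
  proof (intro conjI ballI allI impI)
    show "bij_betw (\<gamma> \<circ> \<beta>) (generated V T (set as)) (generated V T (set cs))"
      using \<beta>(1) \<gamma>(1) bij_betw_trans unfolding substructure_iso_def by blast
    fix f xs assume f: "f \<in> funs V" and xs: "length xs = far V f \<and> set xs \<subseteq> generated V T (set as)"
    have "set (map \<beta> xs) \<subseteq> generated V T (set bs)" using xs img by auto
    then show "(\<gamma> \<circ> \<beta>) (fint T f xs) = fint T f (map (\<gamma> \<circ> \<beta>) xs)"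
      using \<beta>(1) \<gamma>(1) f xs unfolding substructure_iso_def by simp
  next
    fix r xs assume r: "r \<in> rels V" and xs: "length xs = rar V r \<and> set xs \<subseteq> generated V T (set as)"
    have "set (map \<beta> xs) \<subseteq> generated V T (set bs)" using xs img by auto
    then show "rint T r (map (\<gamma> \<circ> \<beta>) xs) = rint T r xs"
      using \<beta>(1) \<gamma>(1) r xs unfolding substructure_iso_def by (simp flip: map_map)
  qed
  then show ?thesis using \<beta>(2) \<gamma>(2) unfolding simeq_def by (intro exI[of _ "\<gamma> \<circ> \<beta>"]) auto
qed

lemma iso_inv:
  assumes "substructure_iso V T (generated V T X) N \<gamma>"
  shows "substructure_iso V T N (generated V T X) (inv_into (generated V T X) \<gamma>)"
proof -
  define M where "M = generated V T X"
  let ?\<beta> = "inv_into M \<gamma>"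
  have bij: "bij_betw \<gamma> M N" using assms unfolding substructure_iso_def M_def by auto
  have retract: "map \<gamma> (map ?\<beta> xs) = xs" "set (map ?\<beta> xs) \<subseteq> M" if "set xs \<subseteq> N" for xs
    using that bij by (auto simp: bij_betw_def inv_into_into f_inv_into_f subset_iff intro!: map_idI)
  have "?\<beta> (fint T f xs) = fint T f (map ?\<beta> xs)"
    if "f \<in> funs V" "length xs = far V f" "set xs \<subseteq> N" for f xs
  proof -
    have "fint T f (map ?\<beta> xs) \<in> M"
      using retract(2)[OF that(3)] that unfolding M_def by (intro generated.app) auto
    moreover have "\<gamma> (fint T f (map ?\<beta> xs)) = fint T f xs"
      using assms that retract[OF that(3)] unfolding substructure_iso_def M_def[symmetric]
      by (metis length_map)
    ultimately show ?thesis using bij by (metis bij_betw_def inv_into_f_f)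
  qed
  moreover have "rint T r (map ?\<beta> xs) = rint T r xs"
    if "r \<in> rels V" "length xs = rar V r" "set xs \<subseteq> N" for r xs
    using assms that retract[OF that(3)] unfolding substructure_iso_def M_def[symmetric]
    by (metis length_map)
  ultimately show ?thesis
    using bij_betw_inv_into[OF bij] unfolding substructure_iso_def M_def by blast
qed

lemma simeq_sym:
  assumes "simeq V T as bs"
  shows "simeq V T bs as"
proof -
  obtain \<beta> where \<beta>: "substructure_iso V T (generated V T (set as)) (generated V T (set bs)) \<beta>"
    "map \<beta> as = bs" using assms unfolding simeq_def by auto
  have "inj_on \<beta> (generated V T (set as))"
    using \<beta>(1) unfolding substructure_iso_def bij_betw_def by auto
  then have "map (inv_into (generated V T (set as)) \<beta>) bs = as"
    unfolding \<beta>(2)[symmetric] by (auto simp: generated.base intro!: map_idI)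
  then show ?thesis using iso_inv[OF \<beta>(1)] unfolding simeq_def by blast
qed

section \<open>Quantifier-free definability\<close>

text \<open>The isomorphism sends the value of a term in \<open>xs\<close> to its value in
  \<open>ys\<close>. Agreement on equalities makes this well defined and injective, term values
  exhaust both substructures, and agreement on relational atoms preserves the relations.\<close>

lemma simeq_if_same_atoms:
  fixes V :: "('f, 'r) vocab"
  assumes len: "length xs = length ys"
    and eq: "\<And>s t. \<lbrakk>wf_tm V s; wf_tm V t; tm_vars s \<subseteq> {..<length xs}; tm_vars t \<subseteq> {..<length xs}\<rbrakk> \<Longrightarrow>
      eval_tm T ((!) xs) s = eval_tm T ((!) xs) t \<longleftrightarrow> eval_tm T ((!) ys) s = eval_tm T ((!) ys) t"
    and rel: "\<And>r ts. \<lbrakk>r \<in> rels V; length ts = rar V r; \<And>t. t \<in> set ts \<Longrightarrow> wf_tm V t;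
        \<And>t. t \<in> set ts \<Longrightarrow> tm_vars t \<subseteq> {..<length xs}\<rbrakk> \<Longrightarrow>
      rint T r (map (eval_tm T ((!) xs)) ts) \<longleftrightarrow> rint T r (map (eval_tm T ((!) ys)) ts)"
  shows "simeq V T xs ys"
proof -
  define ok where "ok t \<longleftrightarrow> wf_tm V t \<and> tm_vars t \<subseteq> {..<length xs}" for t :: "('f, nat) tm"
  define trm where "trm x = (SOME t. ok t \<and> eval_tm T ((!) xs) t = x)" for x
  define \<beta> where "\<beta> x = eval_tm T ((!) ys) (trm x)" for x
  have trm: "ok (trm x) \<and> eval_tm T ((!) xs) (trm x) = x" if "x \<in> generated V T (set xs)" for x
    unfolding trm_def
    by (rule someI_ex) (use generated_is_term_value[OF that] in \<open>auto simp: ok_def\<close>)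
  \<comment> \<open>Independence of the chosen term: \<open>t\<close> and the term chosen for its
    value agree in \<open>xs\<close>, hence also in \<open>ys\<close>.\<close>
  have \<beta>: "\<beta> (eval_tm T ((!) xs) t) = eval_tm T ((!) ys) t" if "ok t" for t
  proof -
    have "eval_tm T ((!) xs) t \<in> generated V T (set xs)"
      using that eval_tm_nth_in_generated unfolding ok_def by blast
    then show ?thesis using trm that eq unfolding \<beta>_def ok_def by blast
  qed
  have inj: "inj_on \<beta> (generated V T (set xs))"
    by (rule inj_onI) (metis trm \<beta>_def eq ok_def)
  have "\<beta> ` generated V T (set xs) = generated V T (set ys)"
  proof (intro equalityI subsetI)
    fix y assume "y \<in> \<beta> ` generated V T (set xs)"
    then show "y \<in> generated V T (set ys)"
      using trm len unfolding \<beta>_def ok_def by (auto intro!: eval_tm_nth_in_generated)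
  next
    fix y assume "y \<in> generated V T (set ys)"
    then obtain t where "ok t" "eval_tm T ((!) ys) t = y"
      using generated_is_term_value[of y V T ys] len unfolding ok_def by auto
    then show "y \<in> \<beta> ` generated V T (set xs)"
      using \<beta> eval_tm_nth_in_generated[of V t xs T] unfolding ok_def by (metis image_eqI)
  qed
  moreover have "\<beta> (fint T f zs) = fint T f (map \<beta> zs)"
    if f: "f \<in> funs V" "length zs = far V f" and zs: "set zs \<subseteq> generated V T (set xs)" for f zs
  proof -
    have "map (eval_tm T ((!) xs)) (map trm zs) = zs" using trm zs by (auto intro!: map_idI)
    moreover have "ok (Fn f (map trm zs))" using trm zs f unfolding ok_def by fastforce
    ultimately show ?thesis using \<beta>[of "Fn f (map trm zs)"] by (simp add: \<beta>_def[abs_def] comp_def)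
  qed
  moreover have "rint T r (map \<beta> zs) = rint T r zs"
    if r: "r \<in> rels V" "length zs = rar V r" and zs: "set zs \<subseteq> generated V T (set xs)" for r zs
  proof -
    have "map (eval_tm T ((!) xs)) (map trm zs) = zs" using trm zs by (auto intro!: map_idI)
    moreover have "ok t" if "t \<in> set (map trm zs)" for t using trm zs that by auto
    ultimately show ?thesis
      using rel[of r "map trm zs"] r unfolding ok_def by (simp add: \<beta>_def[abs_def] comp_def)
  qed
  moreover have "map \<beta> xs = ys"
  proof (rule nth_equalityI)
    fix i assume "i < length (map \<beta> xs)"
    then show "map \<beta> xs ! i = ys ! i" using \<beta>[of "Var i"] by (simp add: ok_def)
  qed (simp add: len)
  ultimately show ?thesis
    using inj unfolding simeq_def substructure_iso_def bij_betw_def by blast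
qed

lemma simeq_same_value:
  assumes "simeq V T xs ys"
  shows "\<exists>\<beta>. inj_on \<beta> (generated V T (set xs)) \<and>
    (\<forall>t. wf_tm V t \<and> tm_vars t \<subseteq> {..<length xs} \<longrightarrow>
        eval_tm T ((!) ys) t = \<beta> (eval_tm T ((!) xs) t)) \<and>
    (\<forall>r zs. r \<in> rels V \<and> length zs = rar V r \<and> set zs \<subseteq> generated V T (set xs) \<longrightarrow>
        rint T r (map \<beta> zs) = rint T r zs)"
proof -
  obtain \<beta> where \<beta>: "substructure_iso V T (generated V T (set xs)) (generated V T (set ys)) \<beta>"
    "map \<beta> xs = ys" using assms unfolding simeq_def by auto
  show ?thesis
    using \<beta>(1) eval_tm_nth_iso[OF \<beta>(1), of _ xs] \<beta>(2)
    by (intro exI[of _ \<beta>]) (auto simp: substructure_iso_def bij_betw_def generated.base subset_iff)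
qed

lemma simeq_atoms:
  assumes "simeq V T xs ys"
  shows "\<lbrakk>wf_tm V s; wf_tm V t; tm_vars s \<subseteq> {..<length xs}; tm_vars t \<subseteq> {..<length xs}\<rbrakk> \<Longrightarrow>
      eval_tm T ((!) ys) s = eval_tm T ((!) ys) t \<longleftrightarrow> eval_tm T ((!) xs) s = eval_tm T ((!) xs) t"
    and "\<lbrakk>r \<in> rels V; length ts = rar V r; \<And>t. t \<in> set ts \<Longrightarrow> wf_tm V t;
        \<And>t. t \<in> set ts \<Longrightarrow> tm_vars t \<subseteq> {..<length xs}\<rbrakk> \<Longrightarrow>
      rint T r (map (eval_tm T ((!) ys)) ts) \<longleftrightarrow> rint T r (map (eval_tm T ((!) xs)) ts)"
proof -
  obtain \<beta> where \<beta>: "inj_on \<beta> (generated V T (set xs))"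
    and val: "\<And>t. wf_tm V t \<Longrightarrow> tm_vars t \<subseteq> {..<length xs} \<Longrightarrow>
        eval_tm T ((!) ys) t = \<beta> (eval_tm T ((!) xs) t)"
    and rel: "\<And>r zs. r \<in> rels V \<Longrightarrow> length zs = rar V r \<Longrightarrow> set zs \<subseteq> generated V T (set xs) \<Longrightarrow>
        rint T r (map \<beta> zs) = rint T r zs"
    using simeq_same_value[OF assms] by metis
  show "eval_tm T ((!) ys) s = eval_tm T ((!) ys) t \<longleftrightarrow> eval_tm T ((!) xs) s = eval_tm T ((!) xs) t"
    if "wf_tm V s" "wf_tm V t" "tm_vars s \<subseteq> {..<length xs}" "tm_vars t \<subseteq> {..<length xs}"
    using that val \<beta> by (metis eval_tm_nth_in_generated inj_on_eq_iff)
  show "rint T r (map (eval_tm T ((!) ys)) ts) \<longleftrightarrow> rint T r (map (eval_tm T ((!) xs)) ts)"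
    if "r \<in> rels V" "length ts = rar V r" "\<And>t. t \<in> set ts \<Longrightarrow> wf_tm V t"
        "\<And>t. t \<in> set ts \<Longrightarrow> tm_vars t \<subseteq> {..<length xs}"
  proof -
    have "map (eval_tm T ((!) ys)) ts = map \<beta> (map (eval_tm T ((!) xs)) ts)"
      using that val by simp
    moreover have "set (map (eval_tm T ((!) xs)) ts) \<subseteq> generated V T (set xs)"
      using that eval_tm_nth_in_generated by fastforce
    moreover have "length (map (eval_tm T ((!) xs)) ts) = rar V r" using that by simp
    ultimately show ?thesis using rel[OF that(1)] by metis
  qed
qed

text \<open>By \<open>simeq_atoms\<close> an atom has a constant truth value on each class, so an
  atom that distinguishes two tuples, negated if necessary, separates their whole classes. Without
  predicate atoms, \<open>{{}}\<close> is the DNF of truth and \<open>{}\<close> that of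
  falsity.\<close>

lemma separating_literal:
  assumes len: "length xs = length ys" and "\<not> simeq V T xs ys"
  shows "\<exists>lit \<in> F_plus V Q ar. qf_vars lit \<subseteq> {..<length xs} \<and>
    (\<forall>zs. simeq V T xs zs \<longrightarrow> cubes T ((!) zs) True lit = {{}}) \<and>
    (\<forall>zs. simeq V T ys zs \<longrightarrow> cubes T ((!) zs) True lit = {})"
proof -
  consider s t where "wf_tm V s" "wf_tm V t" "tm_vars s \<subseteq> {..<length xs}"
      "tm_vars t \<subseteq> {..<length xs}"
      "(eval_tm T ((!) xs) s = eval_tm T ((!) xs) t) \<noteq> (eval_tm T ((!) ys) s = eval_tm T ((!) ys) t)"
    | r ts where "r \<in> rels V" "length ts = rar V r" "\<And>t. t \<in> set ts \<Longrightarrow> wf_tm V t"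
      "\<And>t. t \<in> set ts \<Longrightarrow> tm_vars t \<subseteq> {..<length xs}"
      "rint T r (map (eval_tm T ((!) xs)) ts) \<noteq> rint T r (map (eval_tm T ((!) ys)) ts)"
    using simeq_if_same_atoms[of xs ys V T] assms by blast
  then show ?thesis
  proof cases
    case 1
    have inv: "(eval_tm T ((!) zs) s = eval_tm T ((!) zs) t) = (eval_tm T ((!) us) s = eval_tm T ((!) us) t)"
      if "simeq V T us zs" "length us = length xs" for us zs
      using simeq_atoms(1)[OF that(1) 1(1,2)] 1 that(2) by simp
    let ?lit = "if eval_tm T ((!) xs) s = eval_tm T ((!) xs) t then QEq s t else QNeg (QEq s t)"
    show ?thesis
      by (rule bexI[of _ ?lit]) (use 1 len inv[of xs] inv[of ys] in \<open>auto simp: F_plus_def\<close>)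
  next
    case 2
    have inv: "rint T r (map (eval_tm T ((!) zs)) ts) = rint T r (map (eval_tm T ((!) us)) ts)"
      if "simeq V T us zs" "length us = length xs" for us zs
      using simeq_atoms(2)[OF that(1) 2(1,2)] 2 that(2) by simp
    let ?lit = "if rint T r (map (eval_tm T ((!) xs)) ts) then QRel r ts else QNeg (QRel r ts)"
    show ?thesis
      by (rule bexI[of _ ?lit]) (use 2 len inv[of xs] inv[of ys] in \<open>auto simp: F_plus_def\<close>)
  qed
qed

lemma cubes_foldr_QOr:
  "cubes T e True (foldr QOr fs QBot) = (\<Union>f \<in> set fs. cubes T e True f)"
  by (induction fs) auto

lemma cubes_foldr_QAnd_singletons:
  assumes "\<And>f. f \<in> set fs \<Longrightarrow> cubes T e True f = {h f}"
  shows "cubes T e True (foldr QAnd fs QTop) = {\<Union>f \<in> set fs. h f}"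
  using assms by (induction fs) auto

lemma cubes_foldr_QAnd_empty:
  assumes "f \<in> set fs" "cubes T e True f = {}"
  shows "cubes T e True (foldr QAnd fs QTop) = {}"
  using assms by (induction fs) auto

lemma F_plus_foldr:
  assumes "set fs \<subseteq> F_plus V Q ar"
  shows "foldr QAnd fs QTop \<in> F_plus V Q ar" "foldr QOr fs QBot \<in> F_plus V Q ar"
  using assms by (induction fs) (auto simp: F_plus_def)

lemma qf_vars_foldr:
  "qf_vars (foldr QAnd fs QTop) = (\<Union>f \<in> set fs. qf_vars f)"
  "qf_vars (foldr QOr fs QBot) = (\<Union>f \<in> set fs. qf_vars f)"
  by (induction fs) auto

lemma finite_representatives:
  assumes "finite ((tuples d :: 'n list set) // simeq_rel V T d)"
  shows "\<exists>R. finite R \<and> R \<subseteq> tuples d \<and> (\<forall>xs \<in> tuples d. \<exists>r \<in> R. simeq V T r xs)"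
proof -
  let ?C = "(tuples d :: 'n list set) // simeq_rel V T d"
  define rep where "rep c = (SOME xs. xs \<in> c)" for c :: "'n list set"
  have rep: "rep c \<in> c" if "c \<in> ?C" for c
  proof -
    from that obtain xs where "xs \<in> tuples d" "c = simeq_rel V T d `` {xs}" by (rule quotientE)
    then have "xs \<in> c" using simeq_refl by (auto simp: simeq_rel_def)
    then show ?thesis unfolding rep_def by (rule someI)
  qed
  have "\<exists>r \<in> rep ` ?C. simeq V T r xs" if "xs \<in> tuples d" for xs
  proof -
    have c: "simeq_rel V T d `` {xs} \<in> ?C" using that by (rule quotientI)
    then have "simeq V T xs (rep (simeq_rel V T d `` {xs}))"
      using rep[OF c] by (auto simp: simeq_rel_def)
    then show ?thesis using c by (blast intro: simeq_sym)
  qed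
  moreover have "rep ` ?C \<subseteq> tuples d"
    using rep by (auto simp: quotient_def simeq_rel_def)
  ultimately show ?thesis using assms by (intro exI[of _ "rep ` ?C"]) auto
qed

text \<open>One separating literal for each representative inequivalent to \<open>r\<close> is
  enough, so the conjunction is finite even over an infinite vocabulary.\<close>

lemma simeq_class_definable:
  assumes fin: "finite ((tuples d :: 'n list set) // simeq_rel V T d)" and r: "length r = d"
  shows "\<exists>\<kappa> \<in> F_plus V Q ar. qf_vars \<kappa> \<subseteq> {..<d} \<and>
    (\<forall>zs :: 'n list. length zs = d \<longrightarrow> cubes T ((!) zs) True \<kappa> = (if simeq V T r zs then {{}} else {}))"
proof -
  obtain R where R: "finite R" "R \<subseteq> tuples d" "\<And>xs. xs \<in> tuples d \<Longrightarrow> \<exists>r \<in> R. simeq V T r xs"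
    using finite_representatives[OF fin] by blast
  define R' where "R' = {r' \<in> R. \<not> simeq V T r r'}"
  have "\<exists>lit \<in> F_plus V Q ar. qf_vars lit \<subseteq> {..<d} \<and>
    (\<forall>zs. simeq V T r zs \<longrightarrow> cubes T ((!) zs) True lit = {{}}) \<and>
    (\<forall>zs. simeq V T r' zs \<longrightarrow> cubes T ((!) zs) True lit = {})" if "r' \<in> R'" for r'
  proof -
    have "length r = length r'" "\<not> simeq V T r r'" using that R(2) r unfolding R'_def tuples_def by auto
    then show ?thesis using separating_literal[of r r' V T Q ar] r by simp
  qed
  then obtain lit where lit: "\<And>r'. r' \<in> R' \<Longrightarrow> lit r' \<in> F_plus V Q ar \<and> qf_vars (lit r') \<subseteq> {..<d} \<and>
    (\<forall>zs. simeq V T r zs \<longrightarrow> cubes T ((!) zs) True (lit r') = {{}}) \<and>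
    (\<forall>zs. simeq V T r' zs \<longrightarrow> cubes T ((!) zs) True (lit r') = {})"
    by metis
  have "finite R'" using R(1) by (simp add: R'_def)
  then obtain rs where rs: "set rs = R'" using finite_list by blast
  let ?\<kappa> = "foldr QAnd (map lit rs) QTop"
  have "cubes T ((!) zs) True ?\<kappa> = (if simeq V T r zs then {{}} else {})" if "length zs = d" for zs
  proof (cases "simeq V T r zs")
    case True
    then have "cubes T ((!) zs) True ?\<kappa> = {\<Union>f \<in> set (map lit rs). {}}"
      using lit rs by (intro cubes_foldr_QAnd_singletons) auto
    then show ?thesis using True by simp
  next
    case False
    \<comment> \<open>By transitivity the representative of \<open>zs\<close> is not equivalent to
      \<open>r\<close>, so it contributed a literal, and that literal fails at
      \<open>zs\<close>.\<close>
    obtain r' where r': "r' \<in> R" "simeq V T r' zs" using R(3) \<open>length zs = d\<close> by (auto simp: tuples_def)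
    then have "r' \<in> R'" using False simeq_trans unfolding R'_def by blast
    then have "cubes T ((!) zs) True ?\<kappa> = {}"
      using lit rs r' by (intro cubes_foldr_QAnd_empty[of "lit r'"]) auto
    then show ?thesis using False by simp
  qed
  moreover have "?\<kappa> \<in> F_plus V Q ar" using lit rs by (intro F_plus_foldr) auto
  moreover have "qf_vars ?\<kappa> \<subseteq> {..<d}" using lit rs by (fastforce simp: qf_vars_foldr)
  ultimately show ?thesis by blast
qed

section \<open>Defining equivariant families of configurations\<close>

text \<open>An equivariant family is determined by its values at class representatives. The formula
  is the disjunction, over representatives \<open>r\<close> and \<open>S\<close> in
  \<open>F r\<close>, of the definition of the class of \<open>r\<close> conjoined with the states
  in \<open>S\<close>, their nodes written as terms in \<open>r\<close>. Evaluated at an equivalent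
  tuple, these terms transport \<open>S\<close> along the isomorphism.\<close>

lemma equivariant_family_definable:
  fixes V :: "('f, 'r) vocab" and F :: "'n list \<Rightarrow> ('q, 'n) config set"
  assumes fin: "finite ((tuples d :: 'n list set) // simeq_rel V T d)"
    and fin_F: "\<And>xs. length xs = d \<Longrightarrow> finite (F xs)"
    and fin_S: "\<And>xs S. length xs = d \<Longrightarrow> S \<in> F xs \<Longrightarrow> finite S"
    and local: "\<And>xs S q as. length xs = d \<Longrightarrow> S \<in> F xs \<Longrightarrow> (q, as) \<in> S \<Longrightarrow>
      q \<in> Q \<and> length as = ar q \<and> set as \<subseteq> generated V T (set xs)"
    and equivariant: "\<And>xs S \<gamma>. length xs = d \<Longrightarrow> S \<in> F xs \<Longrightarrow>
      substructure_iso V T (generated V T (set xs)) (generated V T (set (map \<gamma> xs))) \<gamma> \<Longrightarrow>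
      (\<lambda>(q, as). (q, map \<gamma> as)) ` S \<in> F (map \<gamma> xs)"
  shows "\<exists>\<delta> \<in> F_plus V Q ar. qf_vars \<delta> \<subseteq> {..<d} \<and>
    (\<forall>xs. length xs = d \<longrightarrow> cubes T ((!) xs) True \<delta> = F xs)"
proof -
  obtain R where R: "finite R" "R \<subseteq> tuples d" "\<And>xs. xs \<in> tuples d \<Longrightarrow> \<exists>r \<in> R. simeq V T r xs"
    using finite_representatives[OF fin] by blast
  have len_R: "length r = d" if "r \<in> R" for r using R(2) that by (auto simp: tuples_def)
  have "\<forall>r \<in> R. \<exists>\<kappa>. \<kappa> \<in> F_plus V Q ar \<and> qf_vars \<kappa> \<subseteq> {..<d} \<and> (\<forall>zs. length zs = d \<longrightarrow>
      cubes T ((!) zs) True \<kappa> = (if simeq V T r zs then {{}} else {}))"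
    using simeq_class_definable[OF fin, of _ Q ar] len_R unfolding Bex_def by blast
  from bchoice[OF this] obtain \<kappa> where \<kappa>: "\<And>r. r \<in> R \<Longrightarrow> \<kappa> r \<in> F_plus V Q ar \<and> qf_vars (\<kappa> r) \<subseteq> {..<d}"
    "\<And>r zs. r \<in> R \<Longrightarrow> length zs = d \<Longrightarrow>
        cubes T ((!) zs) True (\<kappa> r) = (if simeq V T r zs then {{}} else {})"
    by blast
  \<comment> \<open>A name for the node \<open>x\<close> relative to \<open>r\<close>. It is
    meaningful for nodes generated by \<open>r\<close>, and \<open>local\<close> places all
    arguments of states in \<open>F r\<close> there.\<close>
  define tm where "tm r x = (SOME t. wf_tm V t \<and> tm_vars t \<subseteq> {..<length r} \<and> eval_tm T ((!) r) t = x)" for r x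
  have tm: "wf_tm V (tm r x) \<and> tm_vars (tm r x) \<subseteq> {..<length r} \<and> eval_tm T ((!) r) (tm r x) = x"
    if "x \<in> generated V T (set r)" for r x
    unfolding tm_def using generated_is_term_value[OF that] by (rule someI_ex)
  define atom where "atom r = (\<lambda>(q :: 'q, as). QPred q (map (tm r) as) :: ('f, 'r, 'q, nat) qf)" for r
  define conj where "conj r S = foldr QAnd (map (atom r) (SOME l. set l = S)) QTop" for r S
  have list: "set (SOME l. set l = S) = S" if "finite S" for S :: "('q, 'n) config"
    using finite_list[OF that] by (rule someI_ex)
  have "finite (SIGMA r:R. F r)" using R(1) fin_F len_R by auto
  then obtain ps where ps: "set ps = (SIGMA r:R. F r)" using finite_list by blast
  let ?d = "\<lambda>(r, S). QAnd (\<kappa> r) (conj r S)"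
  let ?\<delta> = "foldr QOr (map ?d ps) QBot"
  have conj: "conj r S \<in> F_plus V Q ar" "qf_vars (conj r S) \<subseteq> {..<d}"
    if "r \<in> R" "S \<in> F r" for r S
  proof -
    have S: "set (SOME l. set l = S) = S" using list fin_S len_R that by blast
    have "atom r s \<in> F_plus V Q ar \<and> qf_vars (atom r s) \<subseteq> {..<d}" if "s \<in> S" for s
    proof (cases s)
      case (Pair q as)
      then have "q \<in> Q" "length as = ar q" "set as \<subseteq> generated V T (set r)"
        using local[OF len_R \<open>S \<in> F r\<close>] that \<open>r \<in> R\<close> by auto
      then show ?thesis
        using Pair tm[of _ r] len_R[OF \<open>r \<in> R\<close>] by (fastforce simp: atom_def F_plus_def)
    qed
    then show "conj r S \<in> F_plus V Q ar" "qf_vars (conj r S) \<subseteq> {..<d}"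
      using S unfolding conj_def by (auto intro!: F_plus_foldr simp: qf_vars_foldr)
  qed
  \<comment> \<open>A state over \<open>r\<close> read at \<open>xs\<close>: each node is replaced
    by the value in \<open>xs\<close> of its name.\<close>
  let ?h = "\<lambda>xs r. \<lambda>(q, as). (q, map (\<lambda>a. eval_tm T ((!) xs) (tm r a)) as)"
  have cubes: "cubes T ((!) xs) True (QAnd (\<kappa> r) (conj r S)) =
      (if simeq V T r xs then {?h xs r ` S} else {})"
    if "r \<in> R" "S \<in> F r" "length xs = d" for r S xs
  proof -
    have S: "set (SOME l. set l = S) = S" using list fin_S len_R that by blast
    have atom: "cubes T ((!) xs) True (atom r s) = {{?h xs r s}}" for s
      by (cases s) (simp add: atom_def comp_def)
    have "cubes T ((!) xs) True (conj r S) =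
        {\<Union>f \<in> set (map (atom r) (SOME l. set l = S)). \<Union>(cubes T ((!) xs) True f)}"
      unfolding conj_def by (rule cubes_foldr_QAnd_singletons) (auto simp: atom)
    also have "\<dots> = {?h xs r ` S}"
      unfolding set_map S image_image UN_simps atom by auto
    finally show ?thesis using \<kappa>(2)[OF that(1,3)] by simp
  qed
  have transport: "eval_tm T ((!) (map \<gamma> r)) (tm r a) = \<gamma> a"
    if "substructure_iso V T (generated V T (set r)) N \<gamma>" "a \<in> generated V T (set r)" for r \<gamma> N a
    using eval_tm_nth_iso[OF that(1), of "tm r a" r] tm[OF that(2)] by (simp add: generated.base subsetI)
  have "cubes T ((!) xs) True ?\<delta> = F xs" if len: "length xs = d" for xs
  proof -
    have "cubes T ((!) xs) True ?\<delta> = (\<Union>p \<in> set ps. cubes T ((!) xs) True (?d p))"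
      by (simp add: cubes_foldr_QOr)
    also have "\<dots> = F xs"
    proof (intro equalityI subsetI)
      fix X assume "X \<in> (\<Union>p \<in> set ps. cubes T ((!) xs) True (?d p))"
      then obtain r S where r: "r \<in> R" "S \<in> F r" and X: "X \<in> cubes T ((!) xs) True (QAnd (\<kappa> r) (conj r S))"
        unfolding ps by auto
      have "simeq V T r xs" and X: "X = ?h xs r ` S"
        using X unfolding cubes[OF r len] by (auto split: if_splits)
      then obtain \<gamma> where \<gamma>: "substructure_iso V T (generated V T (set r)) (generated V T (set xs)) \<gamma>"
        "map \<gamma> r = xs" unfolding simeq_def by blast
      have "X = (\<lambda>(q, as). (q, map \<gamma> as)) ` S"
        unfolding X using local[OF len_R r(2)] r(1) transport[OF \<gamma>(1)] \<gamma>(2)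
        by (intro image_cong refl) (auto simp: subset_iff)
      then show "X \<in> F xs" using equivariant[OF len_R r(2), of \<gamma>] r(1) \<gamma> by simp
    next
      fix S assume S: "S \<in> F xs"
      obtain r where r: "r \<in> R" "simeq V T r xs" using R(3) len by (auto simp: tuples_def)
      then obtain \<gamma> where \<gamma>: "substructure_iso V T (generated V T (set r)) (generated V T (set xs)) \<gamma>"
        "map \<gamma> r = xs" unfolding simeq_def by blast
      \<comment> \<open>For this inclusion \<open>S\<close> is pulled back to the representative
        along the inverse isomorphism; reading the result at \<open>xs\<close> returns
        \<open>S\<close>.\<close>
      define \<beta> where "\<beta> = inv_into (generated V T (set r)) \<gamma>"
      have bij: "bij_betw \<gamma> (generated V T (set r)) (generated V T (set xs))"
        using \<gamma>(1) unfolding substructure_iso_def by blast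
      have "map \<beta> xs = r"
        unfolding \<gamma>(2)[symmetric] \<beta>_def using bij
        by (auto simp: bij_betw_def generated.base intro!: map_idI)
      then have S': "(\<lambda>(q, as). (q, map \<beta> as)) ` S \<in> F r" (is "?S' \<in> _")
        using equivariant[OF len S, of \<beta>] iso_inv[OF \<gamma>(1)] unfolding \<beta>_def by simp
      have retract: "eval_tm T ((!) xs) (tm r (\<beta> a)) = a" if "a \<in> generated V T (set xs)" for a
      proof -
        have "\<beta> a \<in> generated V T (set r)" "\<gamma> (\<beta> a) = a"
          using that bij unfolding \<beta>_def
          by (auto simp: bij_betw_def inv_into_into f_inv_into_f)
        then show ?thesis using transport[OF \<gamma>(1)] \<gamma>(2) by simp
      qed
      have "?h xs r ` ?S' = (\<lambda>s. s) ` S"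
        unfolding image_image using local[OF len S] retract
        by (intro image_cong refl) (auto simp: subset_iff intro!: map_idI)
      then have "S \<in> cubes T ((!) xs) True (QAnd (\<kappa> r) (conj r ?S'))"
        unfolding cubes[OF r(1) S' len] using r(2) by simp
      then have "S \<in> cubes T ((!) xs) True (?d (r, ?S'))" by simp
      then show "S \<in> (\<Union>p \<in> set ps. cubes T ((!) xs) True (?d p))"
        using r(1) S' unfolding ps by blast
    qed
    finally show ?thesis .
  qed
  moreover have "?\<delta> \<in> F_plus V Q ar"
  proof (rule F_plus_foldr(2))
    show "set (map ?d ps) \<subseteq> F_plus V Q ar"
      using \<kappa>(1) conj(1) ps by (auto simp: F_plus_def)
  qed
  moreover have "qf_vars ?\<delta> \<subseteq> {..<d}"
    using \<kappa>(1) conj(2) ps by (fastforce simp: qf_vars_foldr)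
  ultimately show ?thesis by blast
qed

section \<open>Instances of data formulas\<close>

lemma map_tm_eqD:
  assumes "map_tm f t = map_tm g t" "x \<in> tm_vars t"
  shows "f x = g x"
  using assms by (induction t) auto

text \<open>The nodes at free-variable positions can be read off an instance. This is what lets a
  postcondition determine its tuple of nodes.\<close>

lemma map_fm_eqD:
  fixes \<phi> :: "('f, 'r, 'v) fm"
  assumes "map_fm f \<phi> = map_fm g \<phi>" "x \<in> fm_fv \<phi>"
  shows "f x = g x"
proof -
  have tm: "f x = g x"
    if "map_tm (map_sum f id) t = map_tm (map_sum g id) t" "y \<in> tm_vars t" "x \<in> Basic_BNFs.setl y"
    for t :: "('f, 'v + nat) tm" and y
    using map_tm_eqD[OF that(1,2)] that(3) by (cases y) (auto simp: sum_set_defs)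
  show ?thesis
    using assms
  proof (induction \<phi>)
    case (Rel r ts)
    then show ?case using tm by (auto simp: map_eq_conv)
  qed (use tm in auto)
qed

lemma conjuncts_map_fm: "conjuncts (map_fm f \<phi>) = map_fm f ` conjuncts \<phi>"
  by (induction \<phi>) auto

lemma fm_fv_conjuncts: "\<chi> \<in> conjuncts \<phi> \<Longrightarrow> fm_fv \<chi> \<subseteq> fm_fv \<phi>"
  by (induction \<phi>) auto

lemma finite_conjuncts: "finite (conjuncts \<phi>)"
  by (induction \<phi>) auto

lemma conjuncts_nonempty: "conjuncts \<phi> \<noteq> {}"
  by (induction \<phi>) auto

text \<open>Different pairs may denote the same conjunct. The pair is kept because an automaton
  state needs a symbol from a finite set together with its argument nodes.\<close>

definition den :: "('f, 'r, nat) fm \<times> 'n list \<Rightarrow> ('f, 'r, 'n) fm" where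
  "den = (\<lambda>(\<chi>, as). map_fm ((!) as) \<chi>)"

lemma inst_eq_den: "inst \<phi> us = den ` (\<lambda>\<chi>. (\<chi>, us)) ` conjuncts \<phi>"
  by (auto simp: inst_def den_def conjuncts_map_fm)

lemma den_map:
  assumes "fm_fv \<chi> \<subseteq> {..<length as}"
  shows "den (\<chi>, map \<gamma> as) = map_fm \<gamma> (den (\<chi>, as))"
  using assms by (auto simp: den_def fm.map_comp intro!: fm.map_cong)

lemma fm_fv_den: "fm_fv \<chi> \<subseteq> {..<length as} \<Longrightarrow> fm_fv (den (\<chi>, as)) \<subseteq> set as"
  by (auto simp: den_def fm.set_map)

lemma inst_map:
  assumes "fm_fv \<phi> \<subseteq> {..<length us}"
  shows "inst \<phi> (map \<gamma> us) = map_fm \<gamma> ` inst \<phi> us"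
  using den_map[of _ us \<gamma>] fm_fv_conjuncts[of _ \<phi>] assms
  unfolding inst_eq_den image_image by (intro image_cong refl) blast

lemma finite_if_subsingleton:
  assumes "\<And>a b. a \<in> A \<Longrightarrow> b \<in> A \<Longrightarrow> a = b"
  shows "finite A"
proof (cases "A = {}")
  case False
  then obtain a where "a \<in> A" by blast
  then have "A \<subseteq> {a}" using assms by blast
  then show ?thesis by (rule finite_subset) simp
qed simp

lemma closed_sparamD:
  assumes "closed_sparam V T D P" "simeq V T (us @ vs @ ws) (us' @ vs' @ ws')"
    and "(inst \<phi> us, zip \<sigma>s vs, inst \<psi> ws) \<in> P"
    and "fm_ctx D (length us) \<phi>" "fm_ctx D (length ws) \<psi>" "length \<sigma>s = length vs"
    and "length us' = length us" "length vs' = length vs" "length ws' = length ws"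
  shows "(inst \<phi> us', zip \<sigma>s vs', inst \<psi> ws') \<in> P"
  using assms unfolding closed_sparam_def by blast

section \<open>Consequences of a basis in normal form\<close>

text \<open>An element \<open>(\<phi>, \<tau>s, \<sigma>, b, \<psi>, cs)\<close> of \<open>\<B>\<close> stands for the normal form triple whose
  precondition is \<open>\<phi>\<close> at the values of the terms \<open>\<tau>s\<close> in \<open>b # cs\<close>; variable \<open>0\<close> of these terms
  is \<open>b\<close>.\<close>

locale normal_basis =
  fixes V :: "('nf, 'nr) vocab" and T :: "('nf, 'nr, 'n) struct" and D :: "('df, 'dr) vocab"
    and \<B> :: "(('df, 'dr, nat) fm \<times> ('nf, nat) tm list \<times> 's \<times> 'n \<times> ('df, 'dr, nat) fm \<times> 'n list) set"
  assumes finite_basis: "finite \<B>"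
    and pre_ctx: "(\<phi>, \<tau>s, \<sigma>, b, \<psi>, cs) \<in> \<B> \<Longrightarrow> fm_ctx D (length \<tau>s) \<phi>"
    and post_ctx: "(\<phi>, \<tau>s, \<sigma>, b, \<psi>, cs) \<in> \<B> \<Longrightarrow> fm_ctx D (length cs) \<psi>"
    and wf_terms: "(\<phi>, \<tau>s, \<sigma>, b, \<psi>, cs) \<in> \<B> \<Longrightarrow> \<tau> \<in> set \<tau>s \<Longrightarrow>
      wf_tm V \<tau> \<and> tm_vars \<tau> \<subseteq> {..<Suc (length cs)}"
    and post_conjunct: "(\<phi>, \<tau>s, \<sigma>, b, \<psi>, cs) \<in> \<B> \<Longrightarrow> conjuncts \<psi> = {\<psi>}"
begin

text \<open>\<open>step t (\<sigma>, b) S\<close>: an S-param instance of a basis triple has word \<open>\<langle>\<sigma> : b\<rangle>\<close>,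
  postcondition \<open>t\<close> and precondition \<open>den ` S\<close>.\<close>

inductive step ::
  "('df, 'dr, 'n) fm \<Rightarrow> 's \<times> 'n \<Rightarrow> (('df, 'dr, nat) fm \<times> 'n list) set \<Rightarrow> bool" where
  "\<lbrakk>(\<phi>, \<tau>s, \<sigma>, b0, \<psi>, cs0) \<in> \<B>; simeq V T (b0 # cs0) (b # cs)\<rbrakk> \<Longrightarrow>
    step (map_fm ((!) cs) \<psi>) (\<sigma>, b)
      ((\<lambda>\<chi>. (\<chi>, map (eval_tm T ((!) (b # cs))) \<tau>s)) ` conjuncts \<phi>)"

definition conseq ::
  "('df, 'dr, 'n) fm set \<Rightarrow> 's \<times> 'n \<Rightarrow> ('df, 'dr, 'n) fm set" where
  "conseq A l = {t. \<exists>S. step t l S \<and> den ` S \<subseteq> A}"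

lemma conseq_iff: "t \<in> conseq A l \<longleftrightarrow> (\<exists>S. step t l S \<and> den ` S \<subseteq> A)"
  by (simp add: conseq_def)

lemma step_finite: "step t l S \<Longrightarrow> finite S"
  by (auto elim!: step.cases intro: finite_conjuncts)

lemma step_nonempty: "step t l S \<Longrightarrow> S \<noteq> {}"
  by (auto elim!: step.cases simp: conjuncts_nonempty)

lemma fm_fv_post:
  assumes "(\<phi>, \<tau>s, \<sigma>, b0, \<psi>, cs0) \<in> \<B>" "simeq V T (b0 # cs0) (b # cs)"
  shows "fm_fv \<psi> = {..<length cs}" "fm_fv (map_fm ((!) cs) \<psi>) = set cs"
  using post_ctx[OF assms(1)] simeq_length[OF assms(2)]
  by (auto simp: fm_ctx_def fm.set_map set_conv_nth)

text \<open>Each basis triple contributes at most one precondition: every position of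
  \<open>cs\<close> is a free variable of \<open>\<psi>\<close>, so \<open>t\<close> determines
  \<open>cs\<close>, and the precondition nodes are term values in the letter's node and
  \<open>cs\<close>.\<close>

lemma finite_steps: "finite {S. step t l S}"
proof -
  \<comment> \<open>The equation for \<open>l\<close> only says that its command is
    \<open>\<sigma>\<close>; \<open>snd l\<close> is the node that replaces
    \<open>b0\<close>.\<close>
  let ?inst = "\<lambda>(\<phi>, \<tau>s, \<sigma>, b0, \<psi>, cs0). \<lambda>S. \<exists>cs. l = (\<sigma>, snd l) \<and> simeq V T (b0 # cs0) (snd l # cs) \<and>
     t = map_fm ((!) cs) \<psi> \<and> S = (\<lambda>\<chi>. (\<chi>, map (eval_tm T ((!) (snd l # cs))) \<tau>s)) ` conjuncts \<phi>"
  have "{S. step t l S} \<subseteq> (\<Union>x \<in> \<B>. {S. ?inst x S})"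
    by (force elim!: step.cases)
  moreover have "finite (\<Union>x \<in> \<B>. {S. ?inst x S})"
  proof (rule finite_UN_I[OF finite_basis])
    fix x assume "x \<in> \<B>"
    obtain \<phi> \<tau>s \<sigma> b0 \<psi> cs0 where x: "x = (\<phi>, \<tau>s, \<sigma>, b0, \<psi>, cs0)" by (cases x)
    have unique: "cs = cs'"
      if "simeq V T (b0 # cs0) (snd l # cs)" "simeq V T (b0 # cs0) (snd l # cs')"
        "map_fm ((!) cs) \<psi> = map_fm ((!) cs') \<psi>" for cs cs'
    proof (rule nth_equalityI)
      show "length cs = length cs'" using simeq_length[OF that(1)] simeq_length[OF that(2)] by simp
      fix i assume "i < length cs"
      then show "cs ! i = cs' ! i"
        using map_fm_eqD[OF that(3)] fm_fv_post(1)[OF _ that(1)] \<open>x \<in> \<B>\<close> x by blast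
    qed
    show "finite {S. ?inst x S}"
    proof (rule finite_if_subsingleton)
      fix S S' assume "S \<in> {S. ?inst x S}" "S' \<in> {S. ?inst x S}"
      then show "S = S'" using unique unfolding x by auto
    qed
  qed
  ultimately show ?thesis by (rule finite_subset)
qed

text \<open>This is the content of the normal form: going back over a letter never leaves the
  substructure generated by the letter's node and the nodes of the conjunct being derived.\<close>

lemma step_local:
  assumes "step t (\<sigma>, b) S" "(\<chi>, as) \<in> S"
  shows "fm_fv \<chi> \<subseteq> {..<length as}" "set as \<subseteq> generated V T (insert b (fm_fv t))"
  using assms
proof (atomize (full), cases rule: step.cases)
  case (1 \<phi> \<tau>s b0 \<psi> cs0 cs)
  have as: "as = map (eval_tm T ((!) (b # cs))) \<tau>s" and \<chi>: "\<chi> \<in> conjuncts \<phi>"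
    using 1 assms(2) by auto
  have "fm_fv \<chi> \<subseteq> {..<length as}"
    using fm_fv_conjuncts[OF \<chi>] pre_ctx[OF 1(3)] as by (simp add: fm_ctx_def)
  moreover have "set as \<subseteq> generated V T (set (b # cs))"
  proof -
    have "eval_tm T ((!) (b # cs)) \<tau> \<in> generated V T (set (b # cs))" if "\<tau> \<in> set \<tau>s" for \<tau>
      using wf_terms[OF 1(3) that] simeq_length[OF 1(4)] by (intro eval_tm_nth_in_generated) auto
    then show ?thesis unfolding as by auto
  qed
  ultimately show "fm_fv \<chi> \<subseteq> {..<length as} \<and> set as \<subseteq> generated V T (insert b (fm_fv t))"
    using fm_fv_post(2)[OF 1(3,4)] 1(1) by simp
qed

text \<open>A step only asks that \<open>b # cs\<close> be equivalent to a basis tuple. Transitivity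
  preserves this under \<gamma>, and \<gamma> commutes with the terms that give the precondition
  nodes.\<close>

lemma step_equivariant:
  assumes "step t (\<sigma>, b) S" "substructure_iso V T (generated V T X) N \<gamma>"
    and "insert b (fm_fv t) \<subseteq> generated V T X"
  shows "step (map_fm \<gamma> t) (\<sigma>, \<gamma> b) ((\<lambda>(\<chi>, as). (\<chi>, map \<gamma> as)) ` S)"
  using assms(1)
proof cases
  case (1 \<phi> \<tau>s b0 \<psi> cs0 cs)
  note fv = fm_fv_post[OF 1(3,4)]
  have gen: "set (b # cs) \<subseteq> generated V T X" using assms(3) fv(2) 1(1) by simp
  have "simeq V T (b0 # cs0) (\<gamma> b # map \<gamma> cs)"
    using simeq_trans[OF 1(4) simeq_map[OF assms(2) gen]] by simp
  note step.intros[OF 1(3) this]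
  moreover have "map_fm ((!) (map \<gamma> cs)) \<psi> = map_fm \<gamma> t"
    using den_map[of \<psi> cs \<gamma>] fv(1) 1(1) by (simp add: den_def)
  moreover have "map (eval_tm T ((!) (\<gamma> b # map \<gamma> cs))) \<tau>s =
      map \<gamma> (map (eval_tm T ((!) (b # cs))) \<tau>s)"
  proof -
    have "eval_tm T ((!) (map \<gamma> (b # cs))) \<tau> = \<gamma> (eval_tm T ((!) (b # cs)) \<tau>)" if "\<tau> \<in> set \<tau>s" for \<tau>
      using eval_tm_nth_iso[OF assms(2) _ _ gen] wf_terms[OF 1(3) that] simeq_length[OF 1(4)] by simp
    then show ?thesis by simp
  qed
  ultimately show ?thesis unfolding 1(2) image_image by simp
qed

lemma conseq_mono: "A \<subseteq> B \<Longrightarrow> foldl conseq A w \<subseteq> foldl conseq B w"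
proof (induction w rule: rev_induct)
  case (snoc l w)
  then show ?case by (force simp: conseq_iff)
qed simp

text \<open>Induction from the last letter backwards: by \<open>step_local\<close> every conjunct
  needed before that letter again has its nodes in the domain of \<gamma>, so \<gamma> carries over
  the whole derivation and not only its ends.\<close>

lemma conseq_equivariant:
  assumes iso: "substructure_iso V T (generated V T X) N \<gamma>"
    and "t \<in> foldl conseq A w" "fm_fv t \<subseteq> generated V T X" "snd ` set w \<subseteq> generated V T X"
  shows "map_fm \<gamma> t \<in> foldl conseq (map_fm \<gamma> ` A) (map (map_prod id \<gamma>) w)"
  using assms(2-)
proof (induction w arbitrary: t rule: rev_induct)
  case (snoc l w)
  obtain \<sigma> b where l: "l = (\<sigma>, b)" by (cases l)
  obtain S where S: "step t (\<sigma>, b) S" "den ` S \<subseteq> foldl conseq A w"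
    using snoc.prems(1) l by (auto simp: conseq_iff)
  have X: "insert b (fm_fv t) \<subseteq> generated V T X" using snoc.prems l by auto
  have "den (\<chi>, map \<gamma> as) \<in> foldl conseq (map_fm \<gamma> ` A) (map (map_prod id \<gamma>) w)"
    if s: "(\<chi>, as) \<in> S" for \<chi> as
  proof -
    note loc = step_local[OF S(1) s]
    have "fm_fv (den (\<chi>, as)) \<subseteq> generated V T X"
      using fm_fv_den[OF loc(1)] loc(2) generated_least[OF X] by blast
    then have "map_fm \<gamma> (den (\<chi>, as)) \<in> foldl conseq (map_fm \<gamma> ` A) (map (map_prod id \<gamma>) w)"
      using S(2) s snoc.prems(3) by (intro snoc.IH) auto
    then show ?thesis by (simp add: den_map[OF loc(1)])
  qed
  then have "den ` (\<lambda>(\<chi>, as). (\<chi>, map \<gamma> as)) ` S \<subseteq> foldl conseq (map_fm \<gamma> ` A) (map (map_prod id \<gamma>) w)"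
    by auto
  then have "map_fm \<gamma> t \<in> conseq (foldl conseq (map_fm \<gamma> ` A) (map (map_prod id \<gamma>) w)) (\<sigma>, \<gamma> b)"
    using step_equivariant[OF S(1) iso X] unfolding conseq_iff by blast
  then show ?case by (simp add: l id_def)
qed simp

section \<open>Derivability in the proof space and forward consequence\<close>

text \<open>A single application of S-param to a basis triple. The isomorphism for
  \<open>b0 # cs0\<close> is already defined on the precondition nodes, which are term values in
  that tuple, so the tuples of the full triples are equivalent as well.\<close>

lemma step_triple_in_proof_space:
  assumes "proof_space V T D \<Sigma> \<H>"
    and basis: "\<And>\<phi> \<tau>s \<sigma> b \<psi> cs. (\<phi>, \<tau>s, \<sigma>, b, \<psi>, cs) \<in> \<B> \<Longrightarrow>
      (inst \<phi> (map (eval_tm T ((!) (b # cs))) \<tau>s), [(\<sigma>, b)], inst \<psi> cs) \<in> \<H>"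
    and "step t l S"
  shows "(den ` S, [l], {t}) \<in> \<H>"
  using assms(3)
proof cases
  case (1 \<phi> \<tau>s \<sigma> b0 \<psi> cs0 b cs)
  obtain \<gamma> where \<gamma>: "substructure_iso V T (generated V T (set (b0 # cs0))) (generated V T (set (b # cs))) \<gamma>"
    "map \<gamma> (b0 # cs0) = b # cs" using 1(5) unfolding simeq_def by (elim exE conjE) (rule that)
  let ?us = "map (eval_tm T ((!) (b0 # cs0))) \<tau>s" and ?as = "map (eval_tm T ((!) (b # cs))) \<tau>s"
  have eval: "\<gamma> (eval_tm T ((!) (b0 # cs0)) \<tau>) = eval_tm T ((!) (b # cs)) \<tau>"
    "eval_tm T ((!) (b0 # cs0)) \<tau> \<in> generated V T (set (b0 # cs0))" if "\<tau> \<in> set \<tau>s" for \<tau>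
    using eval_tm_nth_iso[OF \<gamma>(1), of \<tau> "b0 # cs0"] eval_tm_nth_in_generated[of V \<tau> "b0 # cs0" T]
      wf_terms[OF 1(4) that] \<gamma>(2) by (auto simp: generated.base subset_iff)
  have "simeq V T (?us @ [b0] @ cs0) (map \<gamma> (?us @ [b0] @ cs0))"
    using eval(2) by (intro simeq_map[OF \<gamma>(1)]) (auto simp: generated.base)
  moreover have "map \<gamma> (?us @ [b0] @ cs0) = ?as @ [b] @ cs"
    using eval(1) \<gamma>(2) by simp
  ultimately have "simeq V T (?us @ [b0] @ cs0) (?as @ [b] @ cs)" by (simp only:)
  moreover have "(inst \<phi> ?us, zip [\<sigma>] [b0], inst \<psi> cs0) \<in> \<H>" using basis[OF 1(4)] by simp
  moreover have "closed_sparam V T D \<H>" using assms(1) by (simp add: proof_space_def)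
  ultimately have "(inst \<phi> ?as, zip [\<sigma>] [b], inst \<psi> cs) \<in> \<H>"
    using pre_ctx[OF 1(4)] post_ctx[OF 1(4)] simeq_length[OF 1(5)]
    by - (rule closed_sparamD[where us = ?us and vs = "[b0]" and ws = cs0]; simp)
  moreover have "inst \<psi> cs = {t}"
    using post_conjunct[OF 1(4)] 1(1) by (simp add: inst_def conjuncts_map_fm)
  moreover have "inst \<phi> ?as = den ` S" using 1(3) by (simp add: inst_eq_den)
  ultimately show ?thesis using 1(2) by simp
qed

text \<open>Conjunction joins the one-letter triples for all members of \<open>C\<close>, and
  Sequencing puts the rest of the word in front. Both \<open>C\<close> and \<open>w\<close> are
  nonempty because the rules by themselves provide no triple to start from for an empty
  postcondition or an empty word.\<close>

lemma conseq_sound: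
  assumes H: "proof_space V T D \<Sigma> \<H>"
    and step: "\<And>t l S. step t l S \<Longrightarrow> (den ` S, [l], {t}) \<in> \<H>"
    and "finite C" "C \<noteq> {}" "C \<subseteq> foldl conseq {Top} w" "w \<noteq> []"
  shows "({Top}, w, C) \<in> \<H>"
  using assms(3-)
proof (induction w arbitrary: C rule: rev_induct)
  case (snoc l w)
  have "\<forall>t \<in> C. \<exists>S. step t l S \<and> den ` S \<subseteq> foldl conseq {Top} w"
    using snoc.prems by (fastforce simp: conseq_iff)
  from bchoice[OF this] obtain g
    where g: "\<And>t. t \<in> C \<Longrightarrow> step t l (g t) \<and> den ` g t \<subseteq> foldl conseq {Top} w" by blast
  have conj: "(A1 \<union> A2, w', B1 \<union> B2) \<in> \<H>" if "(A1, w', B1) \<in> \<H>" "(A2, w', B2) \<in> \<H>" for A1 A2 w' B1 B2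
    using H that unfolding proof_space_def closed_conjunction_def by blast
  have one: "(\<Union>t \<in> E. den ` g t, [l], E) \<in> \<H>" if "finite E" "E \<noteq> {}" "E \<subseteq> C" for E
    using that
  proof (induction E rule: finite_ne_induct)
    case (singleton t)
    then show ?case using step g by auto
  next
    case (insert t E)
    then show ?case using conj[of "den ` g t" "[l]" "{t}" "\<Union>t \<in> E. den ` g t" E] step g by auto
  qed
  let ?A = "\<Union>t \<in> C. den ` g t"
  have A: "(?A, [l], C) \<in> \<H>" using one snoc.prems by auto
  have A': "finite ?A" "?A \<subseteq> foldl conseq {Top} w"
    using snoc.prems(1) g by (auto intro: step_finite)
  have A'': "?A \<noteq> {}"
  proof -
    obtain t where "t \<in> C" using snoc.prems(2) by blast
    then show ?thesis using step_nonempty[of t l "g t"] g by auto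
  qed
  show ?case
  proof (cases "w = []")
    case True
    \<comment> \<open>The one-letter word is the real base case. Preconditions have at least one
      conjunct, so here their union is exactly \<open>{Top}\<close>.\<close>
    then have "?A \<subseteq> {Top}" using A'(2) by simp
    with A'' have "?A = {Top}" by (simp only: subset_singleton_iff simp_thms)
    then show ?thesis using A True by simp
  next
    case False
    then have "({Top}, w, ?A) \<in> \<H>" using snoc.IH[OF A'(1) A'' A'(2)] by blast
    then show ?thesis using A H unfolding proof_space_def closed_sequencing_def by blast
  qed
qed simp

text \<open>The triples of \<open>\<H>\<close> whose postconditions are consequences of their preconditions form a proof
  space containing the basis, hence exhaust \<open>\<H>\<close>. The normal form is what makes S-param preserve
  this: all intermediate assertions live in the substructure generated by the word and the
  postcondition, where the isomorphism is defined.\<close>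

lemma proof_space_lang_eq_conseq:
  assumes gen: "generated_by V T D \<Sigma> \<H> H"
    and H: "H = (\<lambda>(\<phi>, \<tau>s, \<sigma>, b, \<psi>, cs).
      (inst \<phi> (map (eval_tm T ((!) (b # cs))) \<tau>s), [(\<sigma>, b)], inst \<psi> cs)) ` \<B>"
  shows "proof_space_lang \<H> = {w. set w \<subseteq> \<Sigma> \<times> UNIV \<and> Bot \<in> foldl conseq {Top} w}"
proof -
  have ps: "proof_space V T D \<Sigma> \<H>" and H_sub: "H \<subseteq> \<H>" using gen by (auto simp: generated_by_def)
  have basis: "(inst \<phi> (map (eval_tm T ((!) (b # cs))) \<tau>s), [(\<sigma>, b)], inst \<psi> cs) \<in> H"
    if "(\<phi>, \<tau>s, \<sigma>, b, \<psi>, cs) \<in> \<B>" for \<phi> \<tau>s \<sigma> b \<psi> cs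
    using that unfolding H by force
  have step: "(den ` S, [l], {t}) \<in> \<H>" if "step t l S" for t l S
    using step_triple_in_proof_space[OF ps _ that] basis H_sub by blast
  define P where "P = {(A, w, B). (A, w, B) \<in> \<H> \<and> B \<subseteq> foldl conseq A w}"
  have "proof_space V T D \<Sigma> P"
    unfolding proof_space_def
  proof (intro conjI)
    show "P \<subseteq> triples D \<Sigma>" using ps by (auto simp: proof_space_def P_def)
    show "closed_sequencing P"
      unfolding closed_sequencing_def
    proof (intro allI impI)
      fix A1 w1 A2 A2' w2 A3
      assume a: "(A1, w1, A2) \<in> P \<and> (A2', w2, A3) \<in> P \<and> A2' \<subseteq> A2"
      then have "(A1, w1 @ w2, A3) \<in> \<H>"
        using ps unfolding proof_space_def closed_sequencing_def P_def by blast
      moreover have "A3 \<subseteq> foldl conseq A1 (w1 @ w2)"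
      proof -
        have "A3 \<subseteq> foldl conseq A2' w2" "A2' \<subseteq> foldl conseq A1 w1" using a by (auto simp: P_def)
        then show ?thesis using conseq_mono[of A2' "foldl conseq A1 w1" w2] by auto
      qed
      ultimately show "(A1, w1 @ w2, A3) \<in> P" by (simp add: P_def)
    qed
    show "closed_conjunction P"
      unfolding closed_conjunction_def
    proof (intro allI impI)
      fix A1 A2 w B1 B2 assume a: "(A1, w, B1) \<in> P \<and> (A2, w, B2) \<in> P"
      then have "(A1 \<union> A2, w, B1 \<union> B2) \<in> \<H>"
        using ps unfolding proof_space_def closed_conjunction_def P_def by blast
      then show "(A1 \<union> A2, w, B1 \<union> B2) \<in> P"
        using a conseq_mono[of A1 "A1 \<union> A2" w] conseq_mono[of A2 "A1 \<union> A2" w] by (auto simp: P_def)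
    qed
    show "closed_sparam V T D P"
      unfolding closed_sparam_def
    proof (intro allI impI, elim conjE)
      fix \<phi> \<psi> \<sigma>s us vs ws us' vs' ws'
      assume ctx: "fm_ctx D (length us) \<phi>" "fm_ctx D (length ws) \<psi>"
        and len: "length \<sigma>s = length vs" "length us' = length us" "length vs' = length vs"
          "length ws' = length ws"
        and P: "(inst \<phi> us, zip \<sigma>s vs, inst \<psi> ws) \<in> P"
        and sim: "simeq V T (us @ vs @ ws) (us' @ vs' @ ws')"
      have "(inst \<phi> us', zip \<sigma>s vs', inst \<psi> ws') \<in> \<H>"
        using ps P ctx len sim unfolding proof_space_def P_def by (auto intro: closed_sparamD)
      moreover have "inst \<psi> ws' \<subseteq> foldl conseq (inst \<phi> us') (zip \<sigma>s vs')"
      proof -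
        obtain \<gamma> where \<gamma>: "substructure_iso V T (generated V T (set (us @ vs @ ws)))
            (generated V T (set (us' @ vs' @ ws'))) \<gamma>"
          "map \<gamma> (us @ vs @ ws) = us' @ vs' @ ws'" using sim unfolding simeq_def by blast
        have eqs: "us' = map \<gamma> us" "vs' = map \<gamma> vs" "ws' = map \<gamma> ws"
          using \<gamma>(2) len by (auto simp: append_eq_append_conv)
        have \<psi>: "inst \<psi> ws' = map_fm \<gamma> ` inst \<psi> ws" and \<phi>: "inst \<phi> us' = map_fm \<gamma> ` inst \<phi> us"
          using ctx eqs inst_map[of \<psi> ws \<gamma>] inst_map[of \<phi> us \<gamma>] by (auto simp: fm_ctx_def)
        have w: "zip \<sigma>s vs' = map (map_prod id \<gamma>) (zip \<sigma>s vs)"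
          unfolding eqs by (simp add: zip_map2 map_prod_def id_def)
        have "map_fm \<gamma> t \<in> foldl conseq (map_fm \<gamma> ` inst \<phi> us) (map (map_prod id \<gamma>) (zip \<sigma>s vs))"
          if t: "t \<in> inst \<psi> ws" for t
        proof (rule conseq_equivariant[OF \<gamma>(1)])
          show "t \<in> foldl conseq (inst \<phi> us) (zip \<sigma>s vs)" using P t by (auto simp: P_def)
          \<comment> \<open>A conjunct of the postcondition mentions only nodes of
            \<open>ws\<close>, so the backward transport starts inside the domain of
            \<gamma>.\<close>
          obtain \<chi> where "\<chi> \<in> conjuncts \<psi>" "t = den (\<chi>, ws)" using t by (auto simp: inst_eq_den)
          then have "fm_fv t \<subseteq> set ws"
            using fm_fv_den[of \<chi> ws] fm_fv_conjuncts[of \<chi> \<psi>] ctx by (auto simp: fm_ctx_def)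
          then show "fm_fv t \<subseteq> generated V T (set (us @ vs @ ws))" by (auto intro: generated.base)
          show "snd ` set (zip \<sigma>s vs) \<subseteq> generated V T (set (us @ vs @ ws))"
            by (auto dest: set_zip_rightD intro!: generated.base)
        qed
        then show ?thesis unfolding \<psi> \<phi> w by blast
      qed
      ultimately show "(inst \<phi> us', zip \<sigma>s vs', inst \<psi> ws') \<in> P" by (simp add: P_def)
    qed
  qed
  moreover have "H \<subseteq> P"
  proof
    fix h assume h: "h \<in> H"
    then obtain \<phi> \<tau>s \<sigma> b \<psi> cs where B: "(\<phi>, \<tau>s, \<sigma>, b, \<psi>, cs) \<in> \<B>"
      and h': "h = (inst \<phi> (map (eval_tm T ((!) (b # cs))) \<tau>s), [(\<sigma>, b)], inst \<psi> cs)"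
      unfolding H by auto
    have "inst \<psi> cs = {map_fm ((!) cs) \<psi>}"
      using post_conjunct[OF B] by (simp add: inst_def conjuncts_map_fm)
    \<comment> \<open>A basis triple is an S-param instance of itself, hence one forward
      step.\<close>
    then show "h \<in> P"
      using step.intros[OF B simeq_refl] h H_sub unfolding h' P_def
      by (auto simp: conseq_iff inst_eq_den)
  qed
  ultimately have "\<H> \<subseteq> P" using gen by (auto simp: generated_by_def)
  then have complete: "Bot \<in> foldl conseq {Top} w" if "({Top}, w, {Bot}) \<in> \<H>" for w
    using that by (auto simp: P_def)
  have sound: "({Top}, w, {Bot}) \<in> \<H>" if "Bot \<in> foldl conseq {Top} w" for w
  proof -
    have "w \<noteq> []" using that by auto
    then show ?thesis using conseq_sound[OF ps step, of "{Bot}" w] that by auto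
  qed
  have word: "set w \<subseteq> \<Sigma> \<times> UNIV" if "({Top}, w, {Bot}) \<in> \<H>" for w
    using that ps by (auto simp: proof_space_def triples_def)
  have "proof_space_lang \<H> = {w. ({Top}, w, {Bot}) \<in> \<H>}"
    by (simp add: proof_space_lang_def inst_def)
  then show ?thesis using complete sound word by blast
qed

section \<open>The predicate automaton of a basis\<close>

text \<open>The number is the arity. It is recorded because the same conjunct can occur in
  preconditions with different numbers of nodes. The pair \<open>(Bot, 0)\<close> is the initial
  goal.\<close>

definition symbols :: "(('df, 'dr, nat) fm \<times> nat) set" where
  "symbols = insert (Bot, 0) (\<Union>(\<phi>, \<tau>s, _) \<in> \<B>. (\<lambda>\<chi>. (\<chi>, length \<tau>s)) ` conjuncts \<phi>)"

lemma finite_symbols: "finite symbols"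
  using finite_basis finite_conjuncts unfolding symbols_def by auto

lemma symbols_fv: "(\<chi>, m) \<in> symbols \<Longrightarrow> fm_fv \<chi> \<subseteq> {..<m}"
  using pre_ctx fm_fv_conjuncts unfolding symbols_def fm_ctx_def by fastforce

lemma step_symbols: "step t l S \<Longrightarrow> (\<chi>, as) \<in> S \<Longrightarrow> (\<chi>, length as) \<in> symbols"
  unfolding symbols_def by (erule step.cases) force

text \<open>The possible preconditions of a conjunct form an equivariant family in the tuple of the
  letter's node and the state's arguments: \<open>finite_steps\<close>, \<open>step_local\<close>
  and \<open>step_equivariant\<close> are the hypotheses of the definability lemma. The dimension
  \<open>Suc m\<close> counts the letter's node as variable 0.\<close>

lemma transition_definable:
  assumes fin: "finite ((tuples (Suc m) :: 'n list set) // simeq_rel V T (Suc m))"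
    and fv: "fm_fv \<psi> \<subseteq> {..<m}"
    and ix: "\<And>\<chi> k. (\<chi>, k) \<in> symbols \<Longrightarrow> ix (\<chi>, k) \<in> Q \<and> ar (ix (\<chi>, k)) = k"
  shows "\<exists>\<delta> \<in> F_plus V Q ar. qf_vars \<delta> \<subseteq> {..m} \<and> (\<forall>b cs. length cs = m \<longrightarrow>
    cubes T ((!) (b # cs)) True \<delta> =
      {(\<lambda>(\<chi>, as). (ix (\<chi>, length as), as)) ` S | S. step (den (\<psi>, cs)) (\<sigma>, b) S})"
proof -
  let ?enc = "\<lambda>(\<chi>, as :: 'n list). (ix (\<chi>, length as), as)"
  define F where "F xs = {?enc ` S | S. step (den (\<psi>, tl xs)) (\<sigma>, hd xs) S}" for xs
  have "\<exists>\<delta> \<in> F_plus V Q ar. qf_vars \<delta> \<subseteq> {..<Suc m} \<and>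
      (\<forall>xs. length xs = Suc m \<longrightarrow> cubes T ((!) xs) True \<delta> = F xs)"
  proof (rule equivariant_family_definable[OF fin])
    fix xs :: "'n list" assume len: "length xs = Suc m"
    then obtain b cs where xs: "xs = b # cs" and cs: "length cs = m" by (cases xs) auto
    have fv_cs: "fm_fv (den (\<psi>, cs)) \<subseteq> set cs" using fm_fv_den[of \<psi> cs] fv cs by simp
    show "finite (F xs)" using finite_steps unfolding F_def setcompr_eq_image by (rule finite_imageI)
    fix S' assume "S' \<in> F xs"
    then obtain S where S: "S' = ?enc ` S" and st: "step (den (\<psi>, cs)) (\<sigma>, b) S"
      unfolding F_def xs by auto
    show "finite S'" using step_finite[OF st] S by simp
    show "q \<in> Q \<and> length as = ar q \<and> set as \<subseteq> generated V T (set xs)" if s: "(q, as) \<in> S'" for q as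
    proof -
      obtain \<chi> where \<chi>: "(\<chi>, as) \<in> S" "q = ix (\<chi>, length as)" using s unfolding S by auto
      have "generated V T (insert b (fm_fv (den (\<psi>, cs)))) \<subseteq> generated V T (set xs)"
        using fv_cs unfolding xs by (intro generated_least) (auto intro: generated.base)
      then have "set as \<subseteq> generated V T (set xs)" using step_local(2)[OF st \<chi>(1)] by (rule order_trans[rotated])
      then show ?thesis using ix[OF step_symbols[OF st \<chi>(1)]] \<chi>(2) by simp
    qed
    fix \<gamma> assume iso: "substructure_iso V T (generated V T (set xs)) (generated V T (set (map \<gamma> xs))) \<gamma>"
    have "step (map_fm \<gamma> (den (\<psi>, cs))) (\<sigma>, \<gamma> b) ((\<lambda>(\<chi>, as). (\<chi>, map \<gamma> as)) ` S)"
      using fv_cs unfolding xs by (intro step_equivariant[OF st iso]) (auto simp: xs intro: generated.base)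
    then have "step (den (\<psi>, tl (map \<gamma> xs))) (\<sigma>, hd (map \<gamma> xs)) ((\<lambda>(\<chi>, as). (\<chi>, map \<gamma> as)) ` S)"
      using den_map[of \<psi> cs \<gamma>] fv cs by (simp add: xs)
    moreover have "(\<lambda>(q, as). (q, map \<gamma> as)) ` S' = ?enc ` (\<lambda>(\<chi>, as). (\<chi>, map \<gamma> as)) ` S"
      unfolding S image_image by (intro image_cong refl) auto
    ultimately show "(\<lambda>(q, as). (q, map \<gamma> as)) ` S' \<in> F (map \<gamma> xs)"
      unfolding F_def by blast
  qed
  then show ?thesis by (force simp: F_def lessThan_Suc_atMost)
qed

text \<open>A configuration is a set of conjuncts still to be derived. Reading a letter from the
  right, each state picks a step that derives it and is replaced by the precondition of that step,
  so runs are exactly backward searches for forward derivations of \<open>Bot\<close>.\<close>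

lemma conseq_lang_is_PAL:
  assumes fin: "\<And>d. d \<ge> 1 \<Longrightarrow> finite ((tuples d :: 'n list set) // simeq_rel V T d)"
  shows "is_PAL V T \<Sigma> {w. set w \<subseteq> \<Sigma> \<times> UNIV \<and> Bot \<in> foldl conseq {Top} w}"
proof -
  obtain sl where sl: "set sl = symbols" using finite_list[OF finite_symbols] by blast
  \<comment> \<open>Predicate symbols are positions in the list; if a pair is listed repeatedly, one
    of its positions is selected.\<close>
  define ix where "ix p = (SOME i. i < length sl \<and> sl ! i = p)" for p
  have ix: "ix p < length sl \<and> sl ! ix p = p" if "p \<in> symbols" for p
    unfolding ix_def by (rule someI_ex) (use that sl in \<open>auto simp: in_set_conv_nth\<close>)
  define Q where "Q = {..<length sl}"
  define ar where "ar i = snd (sl ! i)" for i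
  define fm where "fm i = fst (sl ! i)" for i
  define enc where "enc = (\<lambda>(\<chi>, as :: 'n list). (ix (\<chi>, length as), as))"
  define dec where "dec = (\<lambda>(i, as :: 'n list). den (fm i, as))"
  \<comment> \<open>The type of configurations also contains ill-formed states, whereas
    \<open>\<delta>\<close> is specified only at well-formed ones.\<close>
  define valid where "valid C \<longleftrightarrow> (\<forall>(i, as) \<in> C. i \<in> Q \<and> length as = ar i)" for C :: "(nat, 'n) config"
  have enc: "valid (enc ` S)" "dec ` enc ` S = den ` S" if "step t l S" for t l S
    using ix step_symbols[OF that]
    by (force simp: valid_def enc_def dec_def Q_def ar_def fm_def image_image split_def intro!: image_cong)+
  define is_\<delta> where "is_\<delta> i \<sigma> \<delta> \<longleftrightarrow> \<delta> \<in> F_plus V Q ar \<and> qf_vars \<delta> \<subseteq> {..ar i} \<and>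
      (\<forall>b cs. length cs = ar i \<longrightarrow>
        cubes T ((!) (b # cs)) True \<delta> = {enc ` S | S. step (den (fm i, cs)) (\<sigma>, b) S})" for i \<sigma> \<delta>
  define \<delta> where "\<delta> i \<sigma> = (SOME \<delta>. is_\<delta> i \<sigma> \<delta>)" for i \<sigma>
  have \<delta>: "is_\<delta> i \<sigma> (\<delta> i \<sigma>)" if "i \<in> Q" for i \<sigma>
  proof -
    have "sl ! i \<in> symbols" using that sl nth_mem by (auto simp: Q_def)
    then have "(fm i, ar i) \<in> symbols" by (simp add: fm_def ar_def)
    then have fv: "fm_fv (fm i) \<subseteq> {..<ar i}" by (rule symbols_fv)
    have "ix (\<chi>, k) \<in> Q \<and> ar (ix (\<chi>, k)) = k" if "(\<chi>, k) \<in> symbols" for \<chi> k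
      using ix[OF that] by (simp add: Q_def ar_def)
    from transition_definable[OF fin fv this, of \<sigma>]
    have "\<exists>\<delta>. is_\<delta> i \<sigma> \<delta>" unfolding is_\<delta>_def enc_def by (simp add: Bex_def)
    then show ?thesis unfolding \<delta>_def by (rule someI_ex)
  qed
  \<comment> \<open>The search starts from the goal \<open>Bot\<close> without nodes and may end
    when only copies of \<open>Top\<close>, the initial forward assertion, remain.\<close>
  define A :: "('nf, 'nr, nat, 's) pa" where
    "A = \<lparr>preds = Q, par = ar, delta = \<delta>, start = QPred (ix (Bot, 0)) [], final = {i \<in> Q. fm i = Top}\<rparr>"
  have bot: "ix (Bot, 0) \<in> Q" "ar (ix (Bot, 0)) = 0" "fm (ix (Bot, 0)) = Bot"
    using ix[of "(Bot, 0)"] by (auto simp: symbols_def Q_def ar_def fm_def)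
  have "wf_pa V \<Sigma> A"
    using \<delta> bot unfolding wf_pa_def A_def by (simp add: is_\<delta>_def) (auto simp: Q_def F_plus_def)
  have init: "pa_initial T A C \<longleftrightarrow> C = {(ix (Bot, 0), [])}" for C :: "(nat, 'n) config"
    by (simp add: pa_initial_def A_def)
  have acc: "pa_accepting A C \<longleftrightarrow> dec ` C \<subseteq> {Top}" if "valid C" for C
  proof -
    \<comment> \<open>Renaming leaves keeps the outermost constructor, so acceptance can be decided
      from the symbol alone.\<close>
    have "dec (i, as) = Top \<longleftrightarrow> fm i = Top" for i as
      by (cases "fm i") (auto simp: dec_def den_def)
    then show ?thesis using that by (fastforce simp: pa_accepting_def A_def valid_def)
  qed
  have cubes: "delta_cubes T A s l = {enc ` S | S. step (dec s) l S}" if "valid {s}" for s l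
    using that \<delta> by (cases s; cases l) (simp add: valid_def A_def dec_def is_\<delta>_def)
  have sub: "valid {s}" if "valid C" "s \<in> C" for C s using that by (auto simp: valid_def)
  have UN: "valid (\<Union>s \<in> C. f s)" if "\<And>s. s \<in> C \<Longrightarrow> valid (f s)" for f and C :: "(nat, 'n) config"
    using that by (auto simp: valid_def)
  \<comment> \<open>Well-formedness passes down a run in reading order; derivability passes back up,
    in the order of the word.\<close>
  have step_down: "valid C'" and step_up: "dec ` C' \<subseteq> B \<Longrightarrow> dec ` C \<subseteq> conseq B l"
    if C: "valid C" and ps: "pa_step T A C l C'" for C l C' B
  proof -
    obtain g where g: "\<And>s. s \<in> C \<Longrightarrow> g s \<in> delta_cubes T A s l" and C': "C' = (\<Union>s \<in> C. g s)"
      using ps by (auto simp: pa_step_def)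
    have g': "\<exists>S. g s = enc ` S \<and> step (dec s) l S" if "s \<in> C" for s
      using g[OF that] cubes[OF sub[OF C that]] by auto
    show "valid C'" unfolding C' using g' enc(1) by (intro UN) metis
    show "dec ` C \<subseteq> conseq B l" if "dec ` C' \<subseteq> B"
    proof
      fix t assume "t \<in> dec ` C"
      then obtain s where s: "s \<in> C" "t = dec s" by blast
      then obtain S where S: "g s = enc ` S" "step t l S" using g' by blast
      have "dec ` g s \<subseteq> B" using that C' s(1) by blast
      then show "t \<in> conseq B l" using S enc(2)[OF S(2)] by (auto simp: conseq_iff)
    qed
  qed
  have step_ex: "\<exists>C'. pa_step T A C l C' \<and> valid C' \<and> dec ` C' \<subseteq> B"
    if C: "valid C" and B: "dec ` C \<subseteq> conseq B l" for C l B
  proof -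
    have "\<forall>s \<in> C. \<exists>S. step (dec s) l S \<and> den ` S \<subseteq> B" using B by (auto simp: conseq_iff)
    from bchoice[OF this] obtain h where h: "\<And>s. s \<in> C \<Longrightarrow> step (dec s) l (h s) \<and> den ` h s \<subseteq> B"
      by blast
    let ?g = "\<lambda>s. enc ` h s"
    have "?g s \<in> delta_cubes T A s l" if "s \<in> C" for s
      using h[OF that] cubes[OF sub[OF C that]] by auto
    then have "pa_step T A C l (\<Union>s \<in> C. ?g s)" unfolding pa_step_def by (intro exI[of _ ?g]) simp
    moreover have "valid (?g s)" "dec ` ?g s \<subseteq> B" if "s \<in> C" for s
      using enc[of "dec s" l "h s"] h[OF that] by simp_all
    then have "valid (\<Union>s \<in> C. ?g s)" "dec ` (\<Union>s \<in> C. ?g s) \<subseteq> B"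
      unfolding image_UN by (intro UN UN_least; blast)+
    ultimately show ?thesis by blast
  qed
  have run_ex: "\<exists>R. R (length w) = C \<and> pa_accepting A (R 0) \<and> (\<forall>r < length w. pa_step T A (R (Suc r)) (w ! r) (R r))"
    if "valid C" "dec ` C \<subseteq> foldl conseq {Top} w" for w C
    using that
  proof (induction w arbitrary: C rule: rev_induct)
    case Nil
    then show ?case using acc by (intro exI[of _ "\<lambda>_. C"]) simp
  next
    case (snoc l w)
    then obtain C' where C': "pa_step T A C l C'" "valid C'" "dec ` C' \<subseteq> foldl conseq {Top} w"
      using step_ex[of C "foldl conseq {Top} w" l] by auto
    from snoc.IH[OF C'(2,3)] obtain R where R: "R (length w) = C'" "pa_accepting A (R 0)"
      "\<And>r. r < length w \<Longrightarrow> pa_step T A (R (Suc r)) (w ! r) (R r)" by blast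
    show ?case
      using R C'(1)
      \<comment> \<open>The appended letter is the first one read, so the run is extended at its
        highest index.\<close>
      by (intro exI[of _ "R(Suc (length w) := C)"]) (auto simp: nth_append less_Suc_eq)
  qed
  have "pa_accepts T A w \<longleftrightarrow> Bot \<in> foldl conseq {Top} w" for w
  proof
    assume "pa_accepts T A w"
    then obtain R where R: "pa_initial T A (R (length w))" "pa_accepting A (R 0)"
      "\<And>r. r < length w \<Longrightarrow> pa_step T A (R (Suc r)) (w ! r) (R r)"
      unfolding pa_accepts_def by blast
    have valid: "valid (R r)" if "r \<le> length w" for r
      using that
    proof (induction r rule: inc_induct)
      case base
      then show ?case using R(1) bot by (simp add: init valid_def)
    next
      case (step r)
      then show ?case using step_down R(3) by blast
    qed
    \<comment> \<open>Configuration \<open>R r\<close> sits just after the first \<open>r\<close>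
      letters of the word, so its goals must be consequences of that prefix.\<close>
    have "dec ` R r \<subseteq> foldl conseq {Top} (take r w)" if "r \<le> length w" for r
      using that
    proof (induction r)
      case 0
      then show ?case using R(2) acc valid by simp
    next
      case (Suc r)
      then show ?case
        using step_up[OF valid R(3), of r] by (simp add: take_Suc_conv_app_nth)
    qed
    from this[of "length w"] show "Bot \<in> foldl conseq {Top} w"
      using R(1) bot(3) by (simp add: init dec_def den_def)
  next
    assume "Bot \<in> foldl conseq {Top} w"
    then have "dec ` {(ix (Bot, 0), [])} \<subseteq> foldl conseq {Top} w" using bot(3) by (simp add: dec_def den_def)
    moreover have "valid {(ix (Bot, 0), [])}" using bot by (simp add: valid_def)
    ultimately show "pa_accepts T A w" using run_ex unfolding pa_accepts_def init by blast
  qed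
  then have "{w. set w \<subseteq> \<Sigma> \<times> UNIV \<and> Bot \<in> foldl conseq {Top} w} = pa_lang T \<Sigma> A"
    by (simp add: pa_lang_def)
  with \<open>wf_pa V \<Sigma> A\<close> show ?thesis unfolding is_PAL_def by blast
qed

end

section \<open>From a basis in normal form to precondition terms\<close>

lemma normal_form_term_witness:
  assumes "triple_normal_form V T D t"
  shows "\<exists>\<phi> \<tau>s \<sigma> b \<psi> cs. t = (inst \<phi> (map (eval_tm T ((!) (b # cs))) \<tau>s), [(\<sigma>, b)], inst \<psi> cs) \<and>
    fm_ctx D (length \<tau>s) \<phi> \<and> fm_ctx D (length cs) \<psi> \<and>
    (\<forall>\<tau> \<in> set \<tau>s. wf_tm V \<tau> \<and> tm_vars \<tau> \<subseteq> {..<Suc (length cs)}) \<and> conjuncts \<psi> = {\<psi>}"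
proof -
  obtain \<phi> as \<sigma> b \<psi> cs where t: "fm_ctx D (length as) \<phi>" "fm_ctx D (length cs) \<psi>"
    "t = (inst \<phi> as, [(\<sigma>, b)], inst \<psi> cs)" "set as \<subseteq> generated V T (insert b (set cs))"
    "\<forall>\<psi>1 \<psi>2. \<psi> \<noteq> And \<psi>1 \<psi>2"
    using assms unfolding triple_normal_form_def by (elim exE conjE) (rule that)
  have "\<forall>a \<in> set as. \<exists>\<tau>. wf_tm V \<tau> \<and> tm_vars \<tau> \<subseteq> {..<length (b # cs)} \<and> eval_tm T ((!) (b # cs)) \<tau> = a"
    using t(4) generated_is_term_value[of _ V T "b # cs"] by (simp add: subset_iff)
  from bchoice[OF this] obtain g where g: "\<And>a. a \<in> set as \<Longrightarrow>
      wf_tm V (g a) \<and> tm_vars (g a) \<subseteq> {..<length (b # cs)} \<and> eval_tm T ((!) (b # cs)) (g a) = a"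
    by blast
  have "map (eval_tm T ((!) (b # cs))) (map g as) = as" using g by (auto intro!: map_idI)
  moreover have "conjuncts \<psi> = {\<psi>}" using t(5) by (cases \<psi>) auto
  ultimately show ?thesis
    using t(1-3) g by (intro exI[of _ \<phi>] exI[of _ "map g as"] exI[of _ \<sigma>] exI[of _ b] exI[of _ \<psi>] exI[of _ cs]) auto
qed

theorem theorem7p10:
  fixes V_Node :: "('nf, 'nr) vocab"
    and T :: "('nf, 'nr, 'n) struct"
    and V_Data :: "('df, 'dr) vocab"
    and \<Sigma> :: "'s set"
    and \<H> H :: "('df, 'dr, 's, 'n) triple set"
  assumes "finite \<Sigma>"
    and "generated_by V_Node T V_Data \<Sigma> \<H> H"
    and "finite H"
    and "basis_normal_form V_Node T V_Data H"
    and "\<And>d. d \<ge> 1 \<Longrightarrow> finite ((tuples d :: 'n list set) // simeq_rel V_Node T d)"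
  shows "is_PAL V_Node T \<Sigma> (proof_space_lang \<H>)"
proof -
  let ?triple = "\<lambda>(\<phi>, \<tau>s, \<sigma>, b, \<psi>, cs). (inst \<phi> (map (eval_tm T ((!) (b # cs))) \<tau>s), [(\<sigma>, b)], inst \<psi> cs)"
  let ?ok = "\<lambda>(\<phi>, \<tau>s, \<sigma>, b, \<psi>, cs). fm_ctx V_Data (length \<tau>s) \<phi> \<and> fm_ctx V_Data (length cs) \<psi> \<and>
    (\<forall>\<tau> \<in> set \<tau>s. wf_tm V_Node \<tau> \<and> tm_vars \<tau> \<subseteq> {..<Suc (length cs)}) \<and> conjuncts \<psi> = {\<psi>}"
  have "\<forall>t \<in> H. \<exists>x. t = ?triple x \<and> ?ok x"
  proof
    fix t assume "t \<in> H"
    then have "triple_normal_form V_Node T V_Data t" using assms(4) by (simp add: basis_normal_form_def)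
    from normal_form_term_witness[OF this] obtain \<phi> \<tau>s \<sigma> b \<psi> cs
      where "t = ?triple (\<phi>, \<tau>s, \<sigma>, b, \<psi>, cs)" "?ok (\<phi>, \<tau>s, \<sigma>, b, \<psi>, cs)"
      by (elim exE conjE) auto
    then show "\<exists>x. t = ?triple x \<and> ?ok x" by (intro exI conjI)
  qed
  \<comment> \<open>One presentation by terms is fixed for each triple, so the presentations form a
    finite set to which the locale applies.\<close>
  from bchoice[OF this] obtain g where "\<forall>t \<in> H. t = ?triple (g t) \<and> ?ok (g t)" by (rule exE)
  then have g: "t = ?triple (g t) \<and> ?ok (g t)" if "t \<in> H" for t using that by (rule bspec)
  interpret normal_basis V_Node T V_Data "g ` H"
  proof
    show "finite (g ` H)" using assms(3) by simp
  qed (use g in fastforce)+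
  have "H = (\<lambda>t. t) ` H" by simp
  also have "\<dots> = ?triple ` g ` H" unfolding image_image using g by (intro image_cong) auto
  finally have "H = ?triple ` g ` H" .
  then show ?thesis
    using proof_space_lang_eq_conseq[OF assms(2)] conseq_lang_is_PAL[OF assms(5)] by simp
qed

end
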